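(* Let $A$ be a closed symmetric relation in a separable Hilbert space $\mathcal H$ and let $\{\mathcal G,\Gamma_0,\Gamma_1\}$ be a quasi boundary triple for $A^*$ with $A_0=\ker\Gamma_0$, $\gamma$-field $\gamma$ and Weyl function $M$. Furthermore, let $\mathfrak A$, $\mathfrak B$ be classes of operator ideals and assume that the following conditions hold: (i) $A_1=\ker\Gamma_1$ is self-adjoint; (ii) $M(\lambda_0)$ is bounded for some $\lambda_0\in\rho(A_0)$; (iii) $\gamma(\lambda_1)^*\in\mathfrak A^*(\mathcal H,\mathcal G)$ for some $\lambda_1\in\rho(A_0)$; (iv) there exists a Hilbert space $\widetilde{\mathcal G}_0$ such that $\mathcal G_0\subset\widetilde{\mathcal G}_0\subset\mathcal G$, where $\mathcal G_0=\operatorname{ran}\Gamma_0$, and the embedding $\iota_{\widetilde{\mathcal G}_0\to\mathcal G}$ belongs to $\mathfrak B(\widetilde{\mathcal G}_0,\mathcal G)$. Then $$(A_1-\lambda)^{-1}-(A_0-\lambda)^{-1}\in(\mathfrak A\cdot\mathfrak B)(\mathcal H)$$ for all $\lambda\in\rho(A_1)\cap\rho(A_0)$.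
   Context: Linear relations. A (closed) linear relation in a Hilbert space $\mathcal H$ is a (closed) linear subspace of $\mathcal H\times\mathcal H$; elements are written $\hat f=\binom{f}{f'}$, and operators are identified with their graphs. $\ker S=\{f:\binom f0\in S\}$, $S-\lambda=\{\binom{f}{f'-\lambda f}:\binom f{f'}\in S\}$. For closed $S$, $\rho(S)$ is the set of $\lambda\in\mathbb C$ such that $(S-\lambda)^{-1}$ is a bounded everywhere defined operator. The adjoint is $S^*=\{\binom g{g'}:(f',g)=(f,g')\text{ for all }\binom f{f'}\in S\}$; $S$ is symmetric if $S\subset S^*$ and self-adjoint if $S=S^*$. Quasi boundary triples. Let $A$ be a closed symmetric relation in $\mathcal H$. $\{\mathcal G,\Gamma_0,\Gamma_1\}$ is a quasi boundary triple for $A^*$ if $\mathcal G$ is a Hilbert space and $\Gamma_0,\Gamma_1:T\to\mathcal G$ are linear mappings defined on a dense subspace $T$ of $A^*$ (dense in $A^*$ with respect to the topology of $\mathcal H\times\mathcal H$) such that $\Gamma=\binom{\Gamma_0}{\Gamma_1}:T\to\mathcal G\times\mathcal G$ has dense range, $\ker\Gamma_0$ is a self-adjoint relation in $\mathcal H$, and $(f',g)-(f,g')=(\Gamma_1\hat f,\Gamma_0\hat g)-(\Gamma_0\hat f,\Gamma_1\hat g)$ for all $\hat f=\binom f{f'},\hat g=\binom g{g'}\in T$. If $\mathcal H$ is separable, so is $\mathcal G$. $\gamma$-field and Weyl function. Let $A_0=\ker\Gamma_0$ and $\mathcal G_0=\operatorname{ran}\Gamma_0$ (dense in $\mathcal G$).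 For $\lambda\in\rho(A_0)$ let $\hat{\mathcal N}_{\lambda,T}=\{\binom{f}{\lambda f}: f\in\ker(T-\lambda)\}$; then $\Gamma_0$ restricted to $\hat{\mathcal N}_{\lambda,T}$ is a bijection onto $\mathcal G_0$. With $\pi_1$ the projection of $\mathcal H\times\mathcal H$ onto the first component, define $\gamma(\lambda)=\pi_1(\Gamma_0\upharpoonright\hat{\mathcal N}_{\lambda,T})^{-1}:\mathcal G_0\to\mathcal H$ and $M(\lambda)=\Gamma_1(\Gamma_0\upharpoonright\hat{\mathcal N}_{\lambda,T})^{-1}:\mathcal G_0\to\mathcal G$, regarded as densely defined operators with domain $\mathcal G_0\subset\mathcal G$ (boundedness of $M(\lambda_0)$ is with respect to the norm of $\mathcal G$). $\gamma(\lambda)$ is bounded, so $\gamma(\lambda)^*\in\mathcal B(\mathcal H,\mathcal G)$. Operator ideals. All Hilbert spaces here are separable; $\mathcal B(\mathcal H,\mathcal K)$ are the bounded, $\mathfrak S_\infty(\mathcal H,\mathcal K)$ the compact operators. A class of operator ideals $\mathfrak A$ consists of subsets $\mathfrak A(\mathcal H,\mathcal K)\subset\mathfrak S_\infty(\mathcal H,\mathcal K)$ for every pair of Hilbert spaces, such that: rank-one operators $x\mapsto(x,u)v$ lie in $\mathfrak A(\mathcal H,\mathcal K)$; $\mathfrak A(\mathcal H,\mathcal K)$ is closed under addition; $CAB\in\mathfrak A(\mathcal H_1,\mathcal K_1)$ for $A\in\mathfrak A(\mathcal H,\mathcal K)$, $B\in\mathcal B(\mathcal H_1,\mathcal H)$,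 $C\in\mathcal B(\mathcal K,\mathcal K_1)$. $\mathfrak A^*(\mathcal K,\mathcal H)=\{A^*:A\in\mathfrak A(\mathcal H,\mathcal K)\}$; $(\mathfrak A\cdot\mathfrak B)(\mathcal H,\mathcal K)$ is the set of products $AB$ with $A\in\mathfrak A(\mathcal G',\mathcal K)$, $B\in\mathfrak B(\mathcal H,\mathcal G')$ for some Hilbert space $\mathcal G'$; $(\mathfrak A\cdot\mathfrak B)(\mathcal H)=(\mathfrak A\cdot\mathfrak B)(\mathcal H,\mathcal H)$. *)

theory Defs
  imports
    Complex_Main
    "HOL-Algebra.Module"
    "HOL-Analysis.Abstract_Metric_Spaces"
begin

text \<open>
  The library has no complex inner product spaces. Moreover, the statement quantifies over classes of
  operator ideals, i.e. over families indexed by pairs of Hilbert spaces, and over Hilbert spaces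
  lying inside a given one and carrying a different norm. Hilbert spaces are therefore records with
  an explicit carrier; all of them have elements in one type \<open>'u\<close>, which is arbitrary and plays the
  role of a universe. The \<open>mult\<close> and \<open>one\<close> fields inherited from the library's module record
  are irrelevant, as for any module.
\<close>

section \<open>Hilbert spaces\<close>

definition complex_ring :: "complex ring"
  where "complex_ring = \<lparr>carrier = UNIV, mult = (*), one = 1, zero = 0, add = (+)\<rparr>"

lemma complex_ring_simps [simp]:
  "carrier complex_ring = UNIV"
  "x \<otimes>\<^bsub>complex_ring\<^esub> y = x * y"
  "x \<oplus>\<^bsub>complex_ring\<^esub> y = x + y"
  "\<one>\<^bsub>complex_ring\<^esub> = 1"
  "\<zero>\<^bsub>complex_ring\<^esub> = 0"
  by (simp_all add: complex_ring_def)

record 'u hilb = "(complex, 'u) Module.module" +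
  ip :: "'u \<Rightarrow> 'u \<Rightarrow> complex"

definition hnorm :: "'u hilb \<Rightarrow> 'u \<Rightarrow> real"
  where "hnorm H x = sqrt (Re (ip H x x))"

text \<open>The locale \<open>Metric_space\<close> demands symmetry and nonnegativity of the distance also outside the
  carrier, where nothing is known about the operations of \<open>H\<close>; hence the guard.\<close>

definition hdist :: "'u hilb \<Rightarrow> 'u \<Rightarrow> 'u \<Rightarrow> real"
  where "hdist H x y = (if x \<in> carrier H \<and> y \<in> carrier H then hnorm H (x \<ominus>\<^bsub>H\<^esub> y) else 0)"

definition htop :: "'u hilb \<Rightarrow> 'u topology"
  where "htop H = Metric_space.mtopology (carrier H) (hdist H)"

text \<open>The inner product is linear in the first argument. Since \<open>ip H x x\<close> is real by \<open>ip_commute\<close>,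
  it suffices to speak about its real part.\<close>

locale cinner_space = Module.module complex_ring H for H :: "'u hilb" (structure) +
  assumes ip_add: "\<lbrakk>x \<in> carrier H; y \<in> carrier H; z \<in> carrier H\<rbrakk>
      \<Longrightarrow> ip H (x \<oplus> y) z = ip H x z + ip H y z"
    and ip_smult: "\<lbrakk>x \<in> carrier H; y \<in> carrier H\<rbrakk> \<Longrightarrow> ip H (c \<odot> x) y = c * ip H x y"
    and ip_commute: "\<lbrakk>x \<in> carrier H; y \<in> carrier H\<rbrakk> \<Longrightarrow> ip H x y = cnj (ip H y x)"
    and ip_nonneg: "x \<in> carrier H \<Longrightarrow> 0 \<le> Re (ip H x x)"
    and ip_definite: "\<lbrakk>x \<in> carrier H; ip H x x = 0\<rbrakk> \<Longrightarrow> x = \<zero>"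
begin

lemma ip_add_right:
  assumes "x \<in> carrier H" "y \<in> carrier H" "z \<in> carrier H"
  shows "ip H z (x \<oplus> y) = ip H z x + ip H z y"
  using assms ip_add ip_commute by (metis add.m_closed complex_cnj_add)

lemma ip_smult_right:
  assumes "x \<in> carrier H" "y \<in> carrier H"
  shows "ip H x (c \<odot> y) = cnj c * ip H x y"
  using assms ip_smult ip_commute
  by (metis UNIV_I complex_cnj_mult complex_ring_simps(1) smult_closed)

lemma ip_uminus:
  assumes "x \<in> carrier H"
  shows "ip H (\<ominus> x) (\<ominus> x) = ip H x x"
proof -
  have z: "ip H \<zero> w = 0" "ip H w \<zero> = 0" if "w \<in> carrier H" for w
    using ip_add[of \<zero> \<zero> w] ip_add_right[of \<zero> \<zero> w] that by simp_all
  have "ip H x x + ip H (\<ominus> x) x = 0"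
    using ip_add[of x "\<ominus> x" x] z assms by (simp add: M.r_neg)
  moreover have "ip H (\<ominus> x) x + ip H (\<ominus> x) (\<ominus> x) = 0"
    using ip_add_right[of x "\<ominus> x" "\<ominus> x"] z assms by (simp add: M.r_neg)
  ultimately show ?thesis by (simp add: add_eq_0_iff)
qed

lemma ip_Re_commute:
  assumes "x \<in> carrier H" "y \<in> carrier H"
  shows "Re (ip H x y) = Re (ip H y x)"
  using ip_commute[OF assms] by simp

lemma hnorm_eq_0_iff:
  assumes "x \<in> carrier H"
  shows "hnorm H x = 0 \<longleftrightarrow> x = \<zero>"
proof
  assume "hnorm H x = 0"
  then have "Re (ip H x x) = 0" by (simp add: hnorm_def)
  moreover have "Im (ip H x x) = 0"
    using ip_commute[OF assms assms] by (metis complex_is_Real_iff Reals_cnj_iff)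
  ultimately show "x = \<zero>" using ip_definite[OF assms] by (simp add: complex_eq_iff)
next
  assume "x = \<zero>"
  moreover have "ip H \<zero> \<zero> = 0"
    using ip_add[of \<zero> \<zero> \<zero>] by simp
  ultimately show "hnorm H x = 0" by (simp add: hnorm_def)
qed

lemma Re_ip_add:
  assumes "x \<in> carrier H" "y \<in> carrier H"
  shows "Re (ip H (x \<oplus> y) (x \<oplus> y)) = Re (ip H x x) + 2 * Re (ip H x y) + Re (ip H y y)"
  using assms ip_Re_commute[of x y] by (simp add: ip_add ip_add_right)

lemma Cauchy_Schwarz_Re:
  assumes "x \<in> carrier H" "y \<in> carrier H"
  shows "Re (ip H x y) \<le> hnorm H x * hnorm H y"
proof -
  let ?a = "Re (ip H x x)" and ?b = "Re (ip H x y)" and ?c = "Re (ip H y y)"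
  have nn: "0 \<le> ?a" "0 \<le> ?c" using assms ip_nonneg by auto
  have *: "0 \<le> ?a + 2 * t * ?b + t\<^sup>2 * ?c" for t :: real
  proof -
    have ty: "complex_of_real t \<odot> y \<in> carrier H" using assms by simp
    have "0 \<le> Re (ip H (x \<oplus> complex_of_real t \<odot> y) (x \<oplus> complex_of_real t \<odot> y))"
      using assms ty ip_nonneg by simp
    then show ?thesis
      using Re_ip_add[OF assms(1) ty] assms ty
      by (simp add: ip_smult ip_smult_right power2_eq_square mult.assoc)
  qed
  have "?b\<^sup>2 \<le> ?a * ?c"
  proof (cases "?c = 0")
    case True
    have "?b = 0"
    proof (rule ccontr)
      assume b: "?b \<noteq> 0"
      have "0 \<le> ?a + 2 * (- (?a + 1) / (2 * ?b)) * ?b" using *[of "- (?a + 1) / (2 * ?b)"] True by simp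
      also have "\<dots> = - 1" using b by (simp add: field_simps)
      finally show False by simp
    qed
    then show ?thesis using True by simp
  next
    case False
    then have c: "0 < ?c" using nn by simp
    have "0 \<le> ?a + 2 * (- ?b / ?c) * ?b + (- ?b / ?c)\<^sup>2 * ?c" by (rule *)
    also have "\<dots> = ?a - ?b\<^sup>2 / ?c" using c by (simp add: field_simps power2_eq_square)
    finally show ?thesis using c by (simp add: field_simps)
  qed
  then have "\<bar>?b\<bar> \<le> sqrt (?a * ?c)" by (metis real_sqrt_abs real_sqrt_le_mono)
  then show ?thesis by (simp add: hnorm_def real_sqrt_mult)
qed

lemma hnorm_triangle:
  assumes "x \<in> carrier H" "y \<in> carrier H"
  shows "hnorm H (x \<oplus> y) \<le> hnorm H x + hnorm H y"
proof -
  have nn: "0 \<le> Re (ip H x x)" "0 \<le> Re (ip H y y)" using assms ip_nonneg by auto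
  have "Re (ip H (x \<oplus> y) (x \<oplus> y)) \<le> (hnorm H x + hnorm H y)\<^sup>2"
    using Re_ip_add[OF assms] Cauchy_Schwarz_Re[OF assms] nn
    by (simp add: power2_sum hnorm_def)
  then show ?thesis
    unfolding hnorm_def[of H "x \<oplus> y"] by (rule real_le_lsqrt[rotated]) (simp add: hnorm_def nn)
qed

lemma Metric_space_hdist: "Metric_space (carrier H) (hdist H)"
proof
  fix x y
  show "0 \<le> hdist H x y"
    by (auto simp: hdist_def hnorm_def intro: ip_nonneg)
  show "hdist H x y = hdist H y x"
  proof (cases "x \<in> carrier H \<and> y \<in> carrier H")
    case True
    then have xy: "x \<in> carrier H" "y \<in> carrier H" by auto
    then have z: "y \<ominus> x \<in> carrier H" by simp
    have "x \<ominus> y = \<ominus> (y \<ominus> x)"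
      using xy by (simp add: a_minus_def M.minus_add M.a_comm)
    then show ?thesis using xy z by (simp add: hdist_def hnorm_def ip_uminus)
  qed (auto simp: hdist_def)
next
  fix x y assume xy: "x \<in> carrier H" "y \<in> carrier H"
  then have "x = (x \<ominus> y) \<oplus> y" "y \<ominus> y = \<zero>"
    by (simp_all add: a_minus_def M.a_assoc M.l_neg M.r_neg)
  then have "x \<ominus> y = \<zero> \<longleftrightarrow> x = y"
    using xy by (metis M.l_zero)
  then show "hdist H x y = 0 \<longleftrightarrow> x = y"
    using xy by (simp add: hdist_def hnorm_eq_0_iff)
next
  fix x y z assume xyz: "x \<in> carrier H" "y \<in> carrier H" "z \<in> carrier H"
  then have "x \<ominus> z = (x \<ominus> y) \<oplus> (y \<ominus> z)"
    by (simp add: a_minus_def a_ac r_neg1 r_neg2)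
  then show "hdist H x z \<le> hdist H x y + hdist H y z"
    using xyz hnorm_triangle[of "x \<ominus> y" "y \<ominus> z"] by (simp add: hdist_def)
qed

end

locale hilbert_space = cinner_space +
  assumes complete: "Metric_space.mcomplete (carrier H) (hdist H)"

locale separable_hilbert_space = hilbert_space +
  assumes separable: "separable_space (htop H)"

section \<open>Linear relations\<close>

text \<open>Operators are identified with their graphs, so that \<open>(f, f') \<in> S\<close> means \<open>S f = f'\<close> and the
  composition \<open>S T\<close> of operators (first \<open>T\<close>, then \<open>S\<close>) is \<open>T O S\<close>.\<close>

definition linear_relation :: "'u hilb \<Rightarrow> 'u hilb \<Rightarrow> ('u \<times> 'u) set \<Rightarrow> bool"
  where "linear_relation H K S \<longleftrightarrow>
    S \<subseteq> carrier H \<times> carrier K \<and> (\<zero>\<^bsub>H\<^esub>, \<zero>\<^bsub>K\<^esub>) \<in> S \<and>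
    (\<forall>f f' g g'. (f, f') \<in> S \<longrightarrow> (g, g') \<in> S \<longrightarrow> (f \<oplus>\<^bsub>H\<^esub> g, f' \<oplus>\<^bsub>K\<^esub> g') \<in> S) \<and>
    (\<forall>c f f'. (f, f') \<in> S \<longrightarrow> (c \<odot>\<^bsub>H\<^esub> f, c \<odot>\<^bsub>K\<^esub> f') \<in> S)"

definition closed_linear_relation :: "'u hilb \<Rightarrow> 'u hilb \<Rightarrow> ('u \<times> 'u) set \<Rightarrow> bool"
  where "closed_linear_relation H K S \<longleftrightarrow>
    linear_relation H K S \<and> closedin (prod_topology (htop H) (htop K)) S"

definition rel_ker :: "'u hilb \<Rightarrow> ('u \<times> 'u) set \<Rightarrow> 'u set"
  where "rel_ker K S = {f. (f, \<zero>\<^bsub>K\<^esub>) \<in> S}"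

definition rel_shift :: "'u hilb \<Rightarrow> ('u \<times> 'u) set \<Rightarrow> complex \<Rightarrow> ('u \<times> 'u) set"
  where "rel_shift H S l = {(f, f' \<ominus>\<^bsub>H\<^esub> l \<odot>\<^bsub>H\<^esub> f) | f f'. (f, f') \<in> S}"

definition rel_plus :: "'u hilb \<Rightarrow> ('u \<times> 'u) set \<Rightarrow> ('u \<times> 'u) set \<Rightarrow> ('u \<times> 'u) set"
  where "rel_plus K S R = {(f, g \<oplus>\<^bsub>K\<^esub> h) | f g h. (f, g) \<in> S \<and> (f, h) \<in> R}"

definition rel_minus :: "'u hilb \<Rightarrow> ('u \<times> 'u) set \<Rightarrow> ('u \<times> 'u) set \<Rightarrow> ('u \<times> 'u) set"
  where "rel_minus K S R = {(f, g \<ominus>\<^bsub>K\<^esub> h) | f g h. (f, g) \<in> S \<and> (f, h) \<in> R}"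

text \<open>Adjoint of a relation from \<open>H\<close> to \<open>K\<close>; it is a relation from \<open>K\<close> to \<open>H\<close>.\<close>

definition rel_adj :: "'u hilb \<Rightarrow> 'u hilb \<Rightarrow> ('u \<times> 'u) set \<Rightarrow> ('u \<times> 'u) set"
  where "rel_adj H K S =
    {(g, g'). g \<in> carrier K \<and> g' \<in> carrier H \<and> (\<forall>(f, f') \<in> S. ip K f' g = ip H f g')}"

definition symmetric_relation :: "'u hilb \<Rightarrow> ('u \<times> 'u) set \<Rightarrow> bool"
  where "symmetric_relation H S \<longleftrightarrow> linear_relation H H S \<and> S \<subseteq> rel_adj H H S"

definition selfadjoint_relation :: "'u hilb \<Rightarrow> ('u \<times> 'u) set \<Rightarrow> bool"
  where "selfadjoint_relation H S \<longleftrightarrow> linear_relation H H S \<and> S = rel_adj H H S"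

definition bounded_relation :: "'u hilb \<Rightarrow> 'u hilb \<Rightarrow> ('u \<times> 'u) set \<Rightarrow> bool"
  where "bounded_relation H K S \<longleftrightarrow> (\<exists>c. \<forall>(x, y) \<in> S. hnorm K y \<le> c * hnorm H x)"

definition bounded_ops :: "'u hilb \<Rightarrow> 'u hilb \<Rightarrow> ('u \<times> 'u) set set"
  where "bounded_ops H K =
    {S. linear_relation H K S \<and> single_valued S \<and> Domain S = carrier H \<and> bounded_relation H K S}"

definition compact_ops :: "'u hilb \<Rightarrow> 'u hilb \<Rightarrow> ('u \<times> 'u) set set"
  where "compact_ops H K =
    {S \<in> bounded_ops H K.
      compactin (htop K) (htop K closure_of (S `` {x \<in> carrier H. hnorm H x \<le> 1}))}"

definition resolvent_set :: "'u hilb \<Rightarrow> ('u \<times> 'u) set \<Rightarrow> complex set"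
  where "resolvent_set H S = {l. (rel_shift H S l)\<inverse> \<in> bounded_ops H H}"

section \<open>Quasi boundary triples\<close>

text \<open>\<open>T\<close> is the common domain of the boundary maps; their values outside \<open>T\<close> are irrelevant.\<close>

definition linear_map_on ::
    "'u hilb \<Rightarrow> ('u \<times> 'u) set \<Rightarrow> 'u hilb \<Rightarrow> ('u \<times> 'u \<Rightarrow> 'u) \<Rightarrow> bool"
  where "linear_map_on H T G \<Gamma> \<longleftrightarrow>
    \<Gamma> ` T \<subseteq> carrier G \<and>
    (\<forall>f f' g g'. (f, f') \<in> T \<longrightarrow> (g, g') \<in> T \<longrightarrow>
      \<Gamma> (f \<oplus>\<^bsub>H\<^esub> g, f' \<oplus>\<^bsub>H\<^esub> g') = \<Gamma> (f, f') \<oplus>\<^bsub>G\<^esub> \<Gamma> (g, g')) \<and>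
    (\<forall>c f f'. (f, f') \<in> T \<longrightarrow> \<Gamma> (c \<odot>\<^bsub>H\<^esub> f, c \<odot>\<^bsub>H\<^esub> f') = c \<odot>\<^bsub>G\<^esub> \<Gamma> (f, f'))"

definition boundary_ker :: "'u hilb \<Rightarrow> ('u \<times> 'u) set \<Rightarrow> ('u \<times> 'u \<Rightarrow> 'u) \<Rightarrow> ('u \<times> 'u) set"
  where "boundary_ker G T \<Gamma> = {f \<in> T. \<Gamma> f = \<zero>\<^bsub>G\<^esub>}"

locale quasi_boundary_triple =
  H: hilbert_space H + G: hilbert_space G
  for H :: "'u hilb" and A T :: "('u \<times> 'u) set" and G :: "'u hilb"
    and \<Gamma>0 \<Gamma>1 :: "'u \<times> 'u \<Rightarrow> 'u" +
  assumes A_closed: "closed_linear_relation H H A"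
    and A_symmetric: "symmetric_relation H A"
    and T_linear: "linear_relation H H T"
    and T_subset: "T \<subseteq> rel_adj H H A"
    and T_dense: "rel_adj H H A \<subseteq> prod_topology (htop H) (htop H) closure_of T"
    and \<Gamma>0_linear: "linear_map_on H T G \<Gamma>0"
    and \<Gamma>1_linear: "linear_map_on H T G \<Gamma>1"
    and dense_range: "prod_topology (htop G) (htop G) closure_of ((\<lambda>f. (\<Gamma>0 f, \<Gamma>1 f)) ` T)
      = carrier G \<times> carrier G"
    and A0_selfadjoint: "selfadjoint_relation H (boundary_ker G T \<Gamma>0)"
    and Green: "\<lbrakk>(f, f') \<in> T; (g, g') \<in> T\<rbrakk> \<Longrightarrow>
      ip H f' g - ip H f g' =
      ip G (\<Gamma>1 (f, f')) (\<Gamma>0 (g, g')) - ip G (\<Gamma>0 (f, f')) (\<Gamma>1 (g, g'))"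

definition defect_rel :: "'u hilb \<Rightarrow> ('u \<times> 'u) set \<Rightarrow> complex \<Rightarrow> ('u \<times> 'u) set"
  where "defect_rel H T l = {(f, l \<odot>\<^bsub>H\<^esub> f) | f. f \<in> rel_ker H (rel_shift H T l)}"

text \<open>Graphs of the \<open>\<gamma>\<close>-field and of the Weyl function, obtained from the graph of the inverse of
  the restriction of \<open>\<Gamma>0\<close> to the defect relation.\<close>

definition gamma_field ::
    "'u hilb \<Rightarrow> ('u \<times> 'u) set \<Rightarrow> ('u \<times> 'u \<Rightarrow> 'u) \<Rightarrow> complex \<Rightarrow> ('u \<times> 'u) set"
  where "gamma_field H T \<Gamma>0 l = {(\<Gamma>0 f, fst f) | f. f \<in> defect_rel H T l}"

definition weyl_function ::
    "'u hilb \<Rightarrow> ('u \<times> 'u) set \<Rightarrow> ('u \<times> 'u \<Rightarrow> 'u) \<Rightarrow> ('u \<times> 'u \<Rightarrow> 'u) \<Rightarrow> complex \<Rightarrow> ('u \<times> 'u) set"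
  where "weyl_function H T \<Gamma>0 \<Gamma>1 l = {(\<Gamma>0 f, \<Gamma>1 f) | f. f \<in> defect_rel H T l}"

section \<open>Classes of operator ideals\<close>

type_synonym 'u op_family = "'u hilb \<Rightarrow> 'u hilb \<Rightarrow> ('u \<times> 'u) set set"

text \<open>A class of operator ideals is indexed by pairs of separable Hilbert spaces. As functions are
  total, such a family is extended by the empty set to all other pairs of records.\<close>

locale operator_ideal_class =
  fixes \<AA> :: "'u op_family"
  assumes index: "S \<in> \<AA> H K \<Longrightarrow> separable_hilbert_space H \<and> separable_hilbert_space K"
    and compact: "\<lbrakk>separable_hilbert_space H; separable_hilbert_space K\<rbrakk> \<Longrightarrow>
      \<AA> H K \<subseteq> compact_ops H K"
    and rank_one: "\<lbrakk>separable_hilbert_space H; separable_hilbert_space K;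
      u \<in> carrier H; v \<in> carrier K\<rbrakk> \<Longrightarrow>
      {(x, ip H x u \<odot>\<^bsub>K\<^esub> v) | x. x \<in> carrier H} \<in> \<AA> H K"
    and add: "\<lbrakk>separable_hilbert_space H; separable_hilbert_space K; S \<in> \<AA> H K; R \<in> \<AA> H K\<rbrakk> \<Longrightarrow>
      rel_plus K S R \<in> \<AA> H K"
    and comp: "\<lbrakk>separable_hilbert_space H; separable_hilbert_space K;
      separable_hilbert_space H1; separable_hilbert_space K1;
      S \<in> \<AA> H K; B \<in> bounded_ops H1 H; C \<in> bounded_ops K K1\<rbrakk> \<Longrightarrow>
      B O S O C \<in> \<AA> H1 K1"

definition adj_class :: "'u op_family \<Rightarrow> 'u op_family"
  where "adj_class \<AA> K H = rel_adj H K ` \<AA> H K"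

definition prod_class :: "'u op_family \<Rightarrow> 'u op_family \<Rightarrow> 'u op_family"
  where "prod_class \<AA> \<BB> H K =
    {R O S | R S G'. separable_hilbert_space G' \<and> S \<in> \<AA> G' K \<and> R \<in> \<BB> H G'}"

end

theory Submission
  imports Defs "HOL-Analysis.Urysohn"
begin

text \<open>
  Let \<open>f\<^sub>j = (A\<^sub>j - z)\<inverse> h\<close>. The difference \<open>d = f\<^sub>1 - f\<^sub>0\<close> lies in \<open>ker (T - z)\<close> and has the same boundary
  value \<open>\<Gamma>\<^sub>0\<close> as \<open>f\<^sub>1\<close>, so that \<open>d = \<gamma>(z) K h\<close> where \<open>K h\<close> denotes this boundary value. Green's identity
  expresses \<open>(K h, \<Gamma>\<^sub>1 g)\<close> for \<open>g \<in> ker (T - cnj z)\<close> as \<open>- (h, g)\<close>. As \<open>ran \<Gamma>\<^sub>1\<close> is dense, \<open>K\<close> is closed, also as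
  an operator into the space \<open>L\<close> whose embedding into \<open>G\<close> lies in the second ideal; hence \<open>K\<close> is bounded
  from \<open>H\<close> to \<open>L\<close>, and the embedding composed with \<open>K\<close> lies in that ideal. On the other side,
  \<open>\<gamma>(z) = (I + (z - \<nu>) (A\<^sub>0 - z)\<inverse>) \<gamma>(\<nu>)\<close>, and \<open>\<gamma>(\<nu>)\<close> is contained in an operator of the first ideal,
  because both have the same adjoint.
\<close>

section \<open>Inner product spaces\<close>

context cinner_space
begin

lemma ip_zero [simp]:
  assumes "x \<in> carrier H"
  shows "ip H \<zero> x = 0" "ip H x \<zero> = 0"
  using ip_add[of \<zero> \<zero> x] ip_add_right[of \<zero> \<zero> x] assms by simp_all

lemma minus_add_cancel:
  assumes "x \<in> carrier H" "y \<in> carrier H"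
  shows "(x \<ominus> y) \<oplus> y = x"
  using assms by (simp add: a_minus_def M.a_assoc M.l_neg)

lemma ip_diff:
  assumes "x \<in> carrier H" "y \<in> carrier H" "z \<in> carrier H"
  shows "ip H (x \<ominus> y) z = ip H x z - ip H y z"
  using ip_add[of "x \<ominus> y" y z] assms by (simp add: minus_add_cancel)

lemma ip_diff_right:
  assumes "x \<in> carrier H" "y \<in> carrier H" "z \<in> carrier H"
  shows "ip H z (x \<ominus> y) = ip H z x - ip H z y"
  using ip_add_right[of "x \<ominus> y" y z] assms by (simp add: minus_add_cancel)

lemmas ip_linear = ip_add ip_add_right ip_smult ip_smult_right ip_diff ip_diff_right

lemma minus_eq_zero_iff:
  assumes "x \<in> carrier H" "y \<in> carrier H"
  shows "x \<ominus> y = \<zero> \<longleftrightarrow> x = y"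
  using assms by (metis minus_add_cancel M.l_zero M.minus_eq M.r_neg)

text \<open>Definiteness, applied to \<open>x \<ominus> y\<close>. Together with
  \<open>ip_linear\<close> it replaces module calculations: vector identities are proved below by
  pairing both sides with an arbitrary \<open>z\<close> and comparing complex numbers.\<close>

lemma ip_eqI:
  assumes x: "x \<in> carrier H" and y: "y \<in> carrier H"
    and eq: "\<And>z. z \<in> carrier H \<Longrightarrow> ip H x z = ip H y z"
  shows "x = y"
proof -
  have "ip H (x \<ominus> y) (x \<ominus> y) = 0"
    using x y eq[of "x \<ominus> y"] by (simp add: ip_diff)
  then show ?thesis using ip_definite[of "x \<ominus> y"] x y by (simp add: minus_eq_zero_iff)
qed

lemma hnorm_nonneg [simp]: "x \<in> carrier H \<Longrightarrow> 0 \<le> hnorm H x"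
  using ip_nonneg by (simp add: hnorm_def)

lemma hnorm_zero [simp]: "hnorm H \<zero> = 0"
  by (simp add: hnorm_def)

lemma hnorm_square: "x \<in> carrier H \<Longrightarrow> (hnorm H x)\<^sup>2 = Re (ip H x x)"
  using ip_nonneg by (simp add: hnorm_def)

lemma hnorm_smult:
  assumes "x \<in> carrier H"
  shows "hnorm H (c \<odot> x) = cmod c * hnorm H x"
proof -
  have "ip H (c \<odot> x) (c \<odot> x) = complex_of_real ((cmod c)\<^sup>2) * ip H x x"
    using assms by (simp add: ip_linear mult.assoc[symmetric] complex_norm_square
        del: of_real_power)
  then show ?thesis by (simp add: hnorm_def real_sqrt_mult)
qed

lemma minus_conv_add: "\<lbrakk>x \<in> carrier H; y \<in> carrier H\<rbrakk> \<Longrightarrow> x \<ominus> y = x \<oplus> (- 1) \<odot> y"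
  by (rule ip_eqI) (simp_all add: ip_linear)

lemma hnorm_minus_le:
  assumes "x \<in> carrier H" "y \<in> carrier H"
  shows "hnorm H (x \<ominus> y) \<le> hnorm H x + hnorm H y"
  using hnorm_triangle[of x "(- 1) \<odot> y"] assms by (simp add: minus_conv_add hnorm_smult)

lemma hnorm_minus_commute:
  assumes "x \<in> carrier H" "y \<in> carrier H"
  shows "hnorm H (x \<ominus> y) = hnorm H (y \<ominus> x)"
proof -
  have "x \<ominus> y = (- 1) \<odot> (y \<ominus> x)"
    using assms by (intro ip_eqI) (simp_all add: ip_linear)
  then show ?thesis using assms by (simp add: hnorm_smult)
qed

lemma hnorm_le_hnorm_minus:
  assumes "x \<in> carrier H" "y \<in> carrier H"
  shows "hnorm H x \<le> hnorm H (x \<ominus> y) + hnorm H y"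
  using hnorm_triangle[of "x \<ominus> y" y] assms by (simp add: minus_add_cancel)

lemma abs_Re_ip_le:
  assumes "x \<in> carrier H" "y \<in> carrier H"
  shows "\<bar>Re (ip H x y)\<bar> \<le> hnorm H x * hnorm H y"
  using Cauchy_Schwarz_Re[of x y] Cauchy_Schwarz_Re[of "(- 1) \<odot> x" y] assms
  by (simp add: hnorm_smult ip_smult abs_le_iff)

text \<open>Cauchy-Schwarz for \<open>xs n \<ominus> x\<close>: norm convergence implies weak
  convergence.\<close>

lemma Re_ip_tendsto:
  assumes xs: "\<And>n. xs n \<in> carrier H" and "x \<in> carrier H" "y \<in> carrier H"
    and lim: "(\<lambda>n. hnorm H (xs n \<ominus> x)) \<longlonglongrightarrow> 0"
  shows "(\<lambda>n. Re (ip H (xs n) y)) \<longlonglongrightarrow> Re (ip H x y)"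
proof (rule LIM_zero_cancel, rule tendsto_rabs_zero_cancel,
    rule tendsto_sandwich[OF _ _ tendsto_const])
  show "(\<lambda>n. hnorm H (xs n \<ominus> x) * hnorm H y) \<longlonglongrightarrow> 0"
    using tendsto_mult_left_zero[OF lim] .
  show "\<forall>\<^sub>F n in sequentially.
      \<bar>Re (ip H (xs n) y) - Re (ip H x y)\<bar> \<le> hnorm H (xs n \<ominus> x) * hnorm H y"
    using abs_Re_ip_le[of "xs _ \<ominus> x" y] assms by (simp add: ip_diff)
qed simp

text \<open>The difference \<open>w\<close> is orthogonal, in real part, to \<open>D\<close>.
  Choosing \<open>d\<close> in \<open>D\<close> within \<open>e\<close> of \<open>w\<close> itself
  gives \<open>\<parallel>w\<parallel>\<^sup>2 = Re (w, w - d) \<le> e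
  \<parallel>w\<parallel>\<close>, so the norm of \<open>w\<close> is at most every positive
  \<open>e\<close>.\<close>

lemma Re_ip_eqI:
  assumes x: "x \<in> carrier H" and y: "y \<in> carrier H"
    and eq: "\<And>z. z \<in> D \<Longrightarrow> Re (ip H x z) = Re (ip H y z)"
    and dense: "\<And>z e. \<lbrakk>z \<in> carrier H; 0 < e\<rbrakk> \<Longrightarrow> \<exists>d \<in> D \<inter> carrier H. hnorm H (z \<ominus> d) < e"
  shows "x = y"
proof -
  define w where "w = x \<ominus> y"
  have w: "w \<in> carrier H" using x y by (simp add: w_def)
  have w_le: "hnorm H w \<le> 0 + e" if e: "0 < e" for e
  proof -
    obtain d where d: "d \<in> D" "d \<in> carrier H" "hnorm H (w \<ominus> d) < e"
      using dense[OF w e] by auto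
    have "Re (ip H w d) = 0" using eq[OF d(1)] x y d by (simp add: w_def ip_diff)
    then have "(hnorm H w)\<^sup>2 = Re (ip H w (w \<ominus> d))"
      using w d by (simp add: hnorm_square ip_diff_right)
    also have "\<dots> \<le> hnorm H w * hnorm H (w \<ominus> d)"
      using Cauchy_Schwarz_Re w d by simp
    also have "\<dots> \<le> hnorm H w * e" using d w by (intro mult_left_mono) auto
    finally show ?thesis
      using e w hnorm_nonneg[OF w] by (cases "hnorm H w = 0") (auto simp: power2_eq_square)
  qed
  have "hnorm H w = 0" using field_le_epsilon[OF w_le] hnorm_nonneg[OF w] by (rule antisym)
  then show ?thesis using w x y by (simp add: hnorm_eq_0_iff w_def minus_eq_zero_iff)
qed

lemma linear_relation_diff:
  assumes "cinner_space K" and S: "linear_relation H K S" and "(f, f') \<in> S" "(g, g') \<in> S"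
  shows "(f \<ominus> g, f' \<ominus>\<^bsub>K\<^esub> g') \<in> S"
proof -
  interpret K: cinner_space K by fact
  have "(f \<oplus> (- 1) \<odot> g, f' \<oplus>\<^bsub>K\<^esub> (- 1) \<odot>\<^bsub>K\<^esub> g') \<in> S"
    using S assms(3,4) unfolding linear_relation_def by blast
  moreover have "f \<in> carrier H" "g \<in> carrier H" "f' \<in> carrier K" "g' \<in> carrier K"
    using S assms(3,4) unfolding linear_relation_def by auto
  ultimately show ?thesis by (simp add: minus_conv_add K.minus_conv_add)
qed

end

section \<open>Elementary rules for linear and bounded relations\<close>

lemma linear_relation_carrier:
  assumes "linear_relation H K S" "(f, f') \<in> S"
  shows "f \<in> carrier H" "f' \<in> carrier K"
  using assms unfolding linear_relation_def by auto

lemma linear_relation_add: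
  "\<lbrakk>linear_relation H K S; (f, f') \<in> S; (g, g') \<in> S\<rbrakk> \<Longrightarrow> (f \<oplus>\<^bsub>H\<^esub> g, f' \<oplus>\<^bsub>K\<^esub> g') \<in> S"
  unfolding linear_relation_def by blast

lemma linear_relation_smult:
  "\<lbrakk>linear_relation H K S; (f, f') \<in> S\<rbrakk> \<Longrightarrow> (c \<odot>\<^bsub>H\<^esub> f, c \<odot>\<^bsub>K\<^esub> f') \<in> S"
  unfolding linear_relation_def by blast

lemma bounded_relationE:
  assumes "bounded_relation H K S"
  obtains c where "\<And>x y. (x, y) \<in> S \<Longrightarrow> hnorm K y \<le> c * hnorm H x"
  using assms unfolding bounded_relation_def by blast

section \<open>Hilbert spaces\<close>

context hilbert_space
begin

text \<open>Moves completeness from the abstract metric \<open>hdist\<close> to norms of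
  differences, so that limits become limits of real sequences.\<close>

lemma Cauchy_converges:
  assumes xs: "\<And>n. xs n \<in> carrier H"
    and Cauchy: "\<And>e. 0 < e \<Longrightarrow> \<exists>N. \<forall>m\<ge>N. \<forall>n\<ge>N. hnorm H (xs m \<ominus> xs n) < e"
  obtains x where "x \<in> carrier H" "(\<lambda>n. hnorm H (xs n \<ominus> x)) \<longlonglongrightarrow> 0"
proof -
  interpret Metric_space "carrier H" "hdist H" by (rule Metric_space_hdist)
  have "MCauchy xs"
    unfolding MCauchy_def using xs Cauchy by (auto simp: hdist_def)
  then obtain x where "limitin mtopology xs x sequentially"
    using complete unfolding mcomplete_def by blast
  then have x: "x \<in> carrier H" and lim: "\<And>e. 0 < e \<Longrightarrow> \<exists>N. \<forall>n\<ge>N. hdist H (xs n) x < e"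
    unfolding limit_metric_sequentially by blast+
  have "(\<lambda>n. hnorm H (xs n \<ominus> x)) \<longlonglongrightarrow> 0"
    unfolding LIMSEQ_def using lim xs x by (simp add: hdist_def dist_real_def)
  then show thesis using that x by blast
qed

text \<open>The representing vector minimises \<open>\<parallel>x\<parallel>\<^sup>2 - 2 Re (\<phi> x)\<close>; minimising sequences are Cauchy by
  the parallelogram law.\<close>

lemma Riesz_representation:
  assumes add: "\<And>x y. \<lbrakk>x \<in> carrier H; y \<in> carrier H\<rbrakk> \<Longrightarrow> \<phi> (x \<oplus> y) = \<phi> x + \<phi> y"
    and smult: "\<And>c x. x \<in> carrier H \<Longrightarrow> \<phi> (c \<odot> x) = c * \<phi> x"
    and bounded: "\<And>x. x \<in> carrier H \<Longrightarrow> \<bar>Re (\<phi> x)\<bar> \<le> b * hnorm H x"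
  obtains u where "u \<in> carrier H" "\<And>x. x \<in> carrier H \<Longrightarrow> \<phi> x = ip H x u"
proof -
  define J where "J x = (hnorm H x)\<^sup>2 - 2 * Re (\<phi> x)" for x
  have "- (b\<^sup>2) \<le> J x" if x: "x \<in> carrier H" for x
  proof -
    have "0 \<le> (hnorm H x - b)\<^sup>2" by simp
    then show ?thesis using bounded[OF x] by (simp add: J_def power2_diff mult.commute)
  qed
  then have bdd: "bdd_below (J ` carrier H)" by (intro bdd_belowI2)
  define d where "d = Inf (J ` carrier H)"
  have d_le: "d \<le> J x" if "x \<in> carrier H" for x
    unfolding d_def using cINF_lower[OF bdd that] .
  have "\<exists>x \<in> carrier H. J x < d + e" if "0 < e" for e
    using cInf_lessD[of "J ` carrier H" "d + e"] that unfolding d_def by auto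
  then have "\<exists>x. x \<in> carrier H \<and> J x < d + inverse (real (Suc n))" for n
    by (meson inverse_positive_iff_positive of_nat_0_less_iff zero_less_Suc)
  then obtain xs where xs: "\<And>n. xs n \<in> carrier H"
    and J_xs: "\<And>n. J (xs n) < d + inverse (real (Suc n))"
    by metis
  \<comment> \<open>The linear part of \<open>J\<close> cancels at the midpoint, which leaves the
    parallelogram law. Nearly minimal values at \<open>x\<close> and \<open>y\<close>, and a value
    of at least \<open>d\<close> at the midpoint, force \<open>x\<close> and \<open>y\<close> close
    together.\<close>
  have parallelogram:
    "(hnorm H (x \<ominus> y))\<^sup>2 = 2 * J x + 2 * J y - 4 * J ((1 / 2) \<odot> (x \<oplus> y))"
    if "x \<in> carrier H" "y \<in> carrier H" for x y
    using that ip_Re_commute[of x y]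
    by (simp add: J_def hnorm_square ip_linear add smult algebra_simps)
  obtain u where u: "u \<in> carrier H" and lim: "(\<lambda>n. hnorm H (xs n \<ominus> u)) \<longlonglongrightarrow> 0"
  proof (rule Cauchy_converges[of xs])
    fix e :: real assume e: "0 < e"
    then obtain N where N: "inverse (real (Suc N)) < e\<^sup>2 / 4"
      using reals_Archimedean[of "e\<^sup>2 / 4"] by auto
    have "hnorm H (xs m \<ominus> xs n) < e" if mn: "m \<ge> N" "n \<ge> N" for m n
    proof -
      have "inverse (real (Suc m)) \<le> inverse (real (Suc N))"
        "inverse (real (Suc n)) \<le> inverse (real (Suc N))"
        using mn by (auto intro!: le_imp_inverse_le)
      moreover have "d \<le> J ((1 / 2) \<odot> (xs m \<oplus> xs n))" using xs by (simp add: d_le)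
      ultimately have "(hnorm H (xs m \<ominus> xs n))\<^sup>2 < e\<^sup>2"
        using parallelogram[OF xs xs, of m n] J_xs[of m] J_xs[of n] N by linarith
      then show ?thesis using e power2_less_imp_less[of _ e] by simp
    qed
    then show "\<exists>N. \<forall>m\<ge>N. \<forall>n\<ge>N. hnorm H (xs m \<ominus> xs n) < e" by blast
  qed (use xs in auto)
  have Re_eq: "Re (\<phi> x) = Re (ip H x u)" if x: "x \<in> carrier H" for x
  proof -
    define r where "r = Re (ip H u x) - Re (\<phi> x)"
    \<comment> \<open>The minimising sequence is shifted by \<open>t x\<close> and \<open>J\<close>
      there is compared with \<open>d\<close>. Passing to the limit only afterwards avoids
      evaluating \<open>J\<close> at \<open>u\<close>.\<close>
    have key: "0 \<le> 2 * t * r + t\<^sup>2 * (hnorm H x)\<^sup>2" for t :: real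
    proof (rule tendsto_lowerbound)
      show "(\<lambda>n. 2 * t * (Re (ip H (xs n) x) - Re (\<phi> x)) + t\<^sup>2 * (hnorm H x)\<^sup>2
            + inverse (real (Suc n))) \<longlonglongrightarrow> 2 * t * r + t\<^sup>2 * (hnorm H x)\<^sup>2"
        unfolding r_def
        by (rule tendsto_add[OF _ LIMSEQ_inverse_real_of_nat, simplified add_0_right])
          (intro tendsto_intros Re_ip_tendsto xs u x lim)
      have "0 \<le> 2 * t * (Re (ip H (xs n) x) - Re (\<phi> x)) + t\<^sup>2 * (hnorm H x)\<^sup>2
            + inverse (real (Suc n))" for n
      proof -
        have "J (xs n \<oplus> of_real t \<odot> x)
            = J (xs n) + 2 * t * (Re (ip H (xs n) x) - Re (\<phi> x)) + t\<^sup>2 * (hnorm H x)\<^sup>2"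
          using xs[of n] x ip_Re_commute[of "xs n" x]
          by (simp add: J_def hnorm_square ip_linear add smult algebra_simps power2_eq_square[of t])
        then show ?thesis using J_xs[of n] d_le[of "xs n \<oplus> of_real t \<odot> x"] xs x by simp
      qed
      then show "\<forall>\<^sub>F n in sequentially. 0 \<le> 2 * t * (Re (ip H (xs n) x) - Re (\<phi> x))
          + t\<^sup>2 * (hnorm H x)\<^sup>2 + inverse (real (Suc n))" by simp
    qed simp
    have "r = 0"
    proof (rule ccontr)
      assume r: "r \<noteq> 0"
      \<comment> \<open>The added 1 allows \<open>x\<close> to be zero. With
        \<open>t = - r / q\<close> the linear term in \<open>key\<close> outweighs the quadratic
        one.\<close>
      define q where "q = (hnorm H x)\<^sup>2 + 1"
      have q: "0 < q" by (simp add: q_def add_nonneg_pos)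
      have "0 \<le> 2 * (- r / q) * r + (- r / q)\<^sup>2 * (q - 1)"
        using key[of "- r / q"] by (simp add: q_def)
      also have "\<dots> = - (r\<^sup>2 / q) - (r / q)\<^sup>2"
        using q by (simp add: field_simps power2_eq_square)
      also have "\<dots> < 0"
      proof -
        have "0 < r\<^sup>2 / q" "0 \<le> (r / q)\<^sup>2" using r q by simp_all
        then show ?thesis by linarith
      qed
      finally show False by simp
    qed
    then show ?thesis using ip_Re_commute[OF u x] by (simp add: r_def)
  qed
  have "\<phi> x = ip H x u" if x: "x \<in> carrier H" for x
    using Re_eq[OF x] Re_eq[of "\<i> \<odot> x"] x u by (simp add: smult ip_smult complex_eq_iff)
  then show thesis using that u by blast
qed

end

text \<open>Riesz representation of the functional sending \<open>x\<close> to
  \<open>(S x, g)\<close>, which is bounded by Cauchy-Schwarz and the bound of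
  \<open>S\<close>.\<close>

lemma bounded_op_adjoint:
  assumes H: "hilbert_space H" and K: "cinner_space K" and S: "S \<in> bounded_ops H K"
    and g: "g \<in> carrier K"
  obtains g' where "(g, g') \<in> rel_adj H K S"
proof -
  interpret H: hilbert_space H by fact
  interpret K: cinner_space K by fact
  have lin: "linear_relation H K S" and sv: "single_valued S" and dom: "Domain S = carrier H"
    and bdd: "bounded_relation H K S"
    using S by (auto simp: bounded_ops_def)
  obtain c where c: "\<And>x y. (x, y) \<in> S \<Longrightarrow> hnorm K y \<le> c * hnorm H x"
    using bounded_relationE[OF bdd] by metis
  define s where "s x = (THE y. (x, y) \<in> S)" for x
  have s_eq: "s x = y" if "(x, y) \<in> S" for x y
    unfolding s_def using that sv by (auto dest: single_valuedD)
  have s: "(x, s x) \<in> S" if "x \<in> carrier H" for x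
    using that dom s_eq by (metis DomainE)
  obtain u where u: "u \<in> carrier H" "\<And>x. x \<in> carrier H \<Longrightarrow> ip K (s x) g = ip H x u"
  proof (rule H.Riesz_representation[of "\<lambda>x. ip K (s x) g" "c * hnorm K g"])
    fix x y assume xy: "x \<in> carrier H" "y \<in> carrier H"
    have "s (x \<oplus>\<^bsub>H\<^esub> y) = s x \<oplus>\<^bsub>K\<^esub> s y"
      using linear_relation_add[OF lin s s] xy by (simp add: s_eq)
    then show "ip K (s (x \<oplus>\<^bsub>H\<^esub> y)) g = ip K (s x) g + ip K (s y) g"
      using linear_relation_carrier[OF lin s] xy g by (simp add: K.ip_add)
  next
    fix a x assume x: "x \<in> carrier H"
    have "s (a \<odot>\<^bsub>H\<^esub> x) = a \<odot>\<^bsub>K\<^esub> s x"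
      using linear_relation_smult[OF lin s] x by (simp add: s_eq)
    then show "ip K (s (a \<odot>\<^bsub>H\<^esub> x)) g = a * ip K (s x) g"
      using linear_relation_carrier[OF lin s] x g by (simp add: K.ip_smult)
  next
    fix x assume x: "x \<in> carrier H"
    have "\<bar>Re (ip K (s x) g)\<bar> \<le> hnorm K (s x) * hnorm K g"
      using linear_relation_carrier[OF lin s] x g by (simp add: K.abs_Re_ip_le)
    also have "\<dots> \<le> c * hnorm H x * hnorm K g"
      using c[OF s[OF x]] g by (simp add: mult_right_mono)
    finally show "\<bar>Re (ip K (s x) g)\<bar> \<le> c * hnorm K g * hnorm H x"
      by (simp add: mult_ac)
  qed (rule that)
  have "(g, u) \<in> rel_adj H K S"
    unfolding rel_adj_def
  proof (clarsimp simp: u(1) g)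
    fix x y assume "(x, y) \<in> S"
    then show "ip K y g = ip H x u"
      using u(2)[of x] s_eq[of x y] linear_relation_carrier[OF lin, of x y] by simp
  qed
  then show thesis by (rule that)
qed

text \<open>By Baire, some set
  \<open>{x. \<parallel>S x\<parallel> \<le> n}\<close> is dense in a ball, so that every \<open>x\<close> is approximated, up to half its norm, by
  some \<open>u\<close> with \<open>\<parallel>S u\<parallel> \<le> C \<parallel>x\<parallel>\<close>. Iterating this, the values of \<open>S\<close> at the remainders form a Cauchy
  sequence, with limit \<open>0\<close> by closedness.\<close>

theorem closed_graph:
  assumes H: "hilbert_space H" and K: "hilbert_space K"
    and lin: "linear_relation H K S" and dom: "Domain S = carrier H"
    and closed: "\<And>xs ys y. \<lbrakk>\<And>n. (xs n, ys n) \<in> S; (\<lambda>n. hnorm H (xs n)) \<longlonglongrightarrow> 0;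
      y \<in> carrier K; (\<lambda>n. hnorm K (ys n \<ominus>\<^bsub>K\<^esub> y)) \<longlonglongrightarrow> 0\<rbrakk> \<Longrightarrow> y = \<zero>\<^bsub>K\<^esub>"
  shows "bounded_relation H K S"
proof -
  interpret H: hilbert_space H by fact
  interpret K: hilbert_space K by fact
  interpret Metric_space "carrier H" "hdist H" by (rule H.Metric_space_hdist)
  note S_carrier = linear_relation_carrier[OF lin]
  note S_diff = H.linear_relation_diff[OF K.cinner_space_axioms lin]
  note S_smult = linear_relation_smult[OF lin]
  define E where "E n = {x. \<exists>y. (x, y) \<in> S \<and> hnorm K y \<le> real n}" for n :: nat
  have "\<exists>n. mtopology interior_of (mtopology closure_of E n) \<noteq> {}"
  proof (rule ccontr)
    assume "\<not> ?thesis"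
    then have "mtopology interior_of (\<Union> (range (\<lambda>n. mtopology closure_of E n))) = {}"
      using H.complete by (intro metric_Baire_category_alt) auto
    moreover have "(\<Union> (range (\<lambda>n. mtopology closure_of E n))) = carrier H"
    proof (rule antisym)
      show "\<Union> (range (\<lambda>n. mtopology closure_of E n)) \<subseteq> carrier H"
        using closure_of_subset_topspace[of mtopology] by fastforce
      show "carrier H \<subseteq> \<Union> (range (\<lambda>n. mtopology closure_of E n))"
      proof
        fix x assume x: "x \<in> carrier H"
        then obtain y where y: "(x, y) \<in> S" using dom by blast
        obtain n where "hnorm K y \<le> real n" using real_arch_simple by blast
        then have "x \<in> E n" using y by (auto simp: E_def)
        moreover have "E n \<subseteq> mtopology closure_of E n"
          using S_carrier by (intro closure_of_subset) (auto simp: E_def)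
        ultimately show "x \<in> \<Union> (range (\<lambda>n. mtopology closure_of E n))" by blast
      qed
    qed
    ultimately have "carrier H = {}"
      using interior_of_topspace[of mtopology] by simp
    then show False using H.M.zero_closed by blast
  qed
  then obtain n a where "a \<in> mtopology interior_of (mtopology closure_of E n)" by blast
  then obtain r where r: "0 < r"
    and ball: "mball a r \<subseteq> mtopology interior_of (mtopology closure_of E n)"
    using openin_interior_of[of mtopology] by (meson openin_mtopology)
  have a: "a \<in> carrier H"
    using \<open>a \<in> _\<close> interior_of_subset_topspace[of mtopology] by fastforce
  have near: "\<exists>u v. (u, v) \<in> S \<and> hnorm K v \<le> real n \<and> hnorm H (x \<ominus>\<^bsub>H\<^esub> u) < e"
    if x: "x \<in> carrier H" and xa: "hnorm H (a \<ominus>\<^bsub>H\<^esub> x) < r" and e: "0 < e" for x e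
  proof -
    have "x \<in> mball a r" using x a xa by (simp add: hdist_def)
    then have "x \<in> mtopology closure_of E n"
      using ball interior_of_subset[of mtopology "mtopology closure_of E n"] by blast
    then show ?thesis using e unfolding metric_closure_of E_def by (fastforce simp: hdist_def)
  qed
  \<comment> \<open>The value needed in \<open>approx\<close>: a difference of two values of norm at
    most \<open>n\<close>, divided by \<open>t = r / (2 \<parallel>x\<parallel>)\<close>, has norm
    at most \<open>4 n / r\<close> times \<open>\<parallel>x\<parallel>\<close>.\<close>
  define C where "C = 4 * real n / r"
  have C: "0 \<le> C" using r by (simp add: C_def)
  have approx: "\<exists>u v. (u, v) \<in> S \<and> hnorm H (x \<ominus>\<^bsub>H\<^esub> u) \<le> hnorm H x / 2 \<and> hnorm K v \<le> C * hnorm H x"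
    if x: "x \<in> carrier H" for x
  proof (cases "x = \<zero>\<^bsub>H\<^esub>")
    case True
    have "(\<zero>\<^bsub>H\<^esub>, \<zero>\<^bsub>K\<^esub>) \<in> S" using lin by (simp add: linear_relation_def)
    moreover have "x \<ominus>\<^bsub>H\<^esub> \<zero>\<^bsub>H\<^esub> = \<zero>\<^bsub>H\<^esub>" using True by (simp add: H.minus_eq_zero_iff)
    ultimately show ?thesis using True by (intro exI[of _ "\<zero>\<^bsub>H\<^esub>"] exI[of _ "\<zero>\<^bsub>K\<^esub>"]) simp
  next
    case False
    then have nx: "0 < hnorm H x"
      using x H.hnorm_eq_0_iff[OF x] H.hnorm_nonneg[OF x] by linarith
    \<comment> \<open>The vector \<open>t x\<close> has length \<open>r / 2\<close>, so
      \<open>a\<close> and \<open>p = a + t x\<close> both lie in the ball about \<open>a\<close>.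
      Approximating each within \<open>r / 8\<close>, subtracting and dividing by \<open>t\<close>
      approximates \<open>x\<close> with error at most
      \<open>\<parallel>x\<parallel> / 2\<close>.\<close>
    define t where "t = r / (2 * hnorm H x)"
    have t: "0 < t" using r nx by (simp add: t_def)
    let ?t = "complex_of_real t" and ?t' = "complex_of_real (1 / t)"
    define p where "p = a \<oplus>\<^bsub>H\<^esub> ?t \<odot>\<^bsub>H\<^esub> x"
    have p: "p \<in> carrier H" using a x by (simp add: p_def)
    have "a \<ominus>\<^bsub>H\<^esub> p = (- ?t) \<odot>\<^bsub>H\<^esub> x"
      unfolding p_def using a x by (intro H.ip_eqI) (simp_all add: H.ip_linear)
    then have "hnorm H (a \<ominus>\<^bsub>H\<^esub> p) = t * hnorm H x" using x t by (simp add: H.hnorm_smult)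
    also have "\<dots> < r" using r nx by (simp add: t_def)
    finally obtain u1 v1 where 1: "(u1, v1) \<in> S" "hnorm K v1 \<le> real n"
      "hnorm H (p \<ominus>\<^bsub>H\<^esub> u1) < r / 8"
      using near[OF p, of "r / 8"] r by auto
    have "hnorm H (a \<ominus>\<^bsub>H\<^esub> a) < r" using a r by (simp add: H.minus_eq_zero_iff[THEN iffD2])
    then obtain u2 v2 where 2: "(u2, v2) \<in> S" "hnorm K v2 \<le> real n"
      "hnorm H (a \<ominus>\<^bsub>H\<^esub> u2) < r / 8"
      using near[OF a, of "r / 8"] r by auto
    note u = S_carrier[OF 1(1)] S_carrier[OF 2(1)]
    have "(?t' \<odot>\<^bsub>H\<^esub> (u1 \<ominus>\<^bsub>H\<^esub> u2), ?t' \<odot>\<^bsub>K\<^esub> (v1 \<ominus>\<^bsub>K\<^esub> v2)) \<in> S"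
      using S_smult S_diff 1 2 by blast
    moreover have "hnorm H (x \<ominus>\<^bsub>H\<^esub> ?t' \<odot>\<^bsub>H\<^esub> (u1 \<ominus>\<^bsub>H\<^esub> u2)) \<le> hnorm H x / 2"
    proof -
      have "x \<ominus>\<^bsub>H\<^esub> ?t' \<odot>\<^bsub>H\<^esub> (u1 \<ominus>\<^bsub>H\<^esub> u2) = ?t' \<odot>\<^bsub>H\<^esub> ((p \<ominus>\<^bsub>H\<^esub> u1) \<ominus>\<^bsub>H\<^esub> (a \<ominus>\<^bsub>H\<^esub> u2))"
        unfolding p_def using a x u t
        by (intro H.ip_eqI) (simp_all add: H.ip_linear field_simps)
      then have "hnorm H (x \<ominus>\<^bsub>H\<^esub> ?t' \<odot>\<^bsub>H\<^esub> (u1 \<ominus>\<^bsub>H\<^esub> u2))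
          = (1 / t) * hnorm H ((p \<ominus>\<^bsub>H\<^esub> u1) \<ominus>\<^bsub>H\<^esub> (a \<ominus>\<^bsub>H\<^esub> u2))"
        using a p u t by (simp add: H.hnorm_smult norm_divide)
      also have "\<dots> \<le> (1 / t) * (r / 8 + r / 8)"
        using H.hnorm_minus_le[of "p \<ominus>\<^bsub>H\<^esub> u1" "a \<ominus>\<^bsub>H\<^esub> u2"] a p u t 1 2
        by (intro mult_left_mono) auto
      also have "\<dots> = hnorm H x / 2" using r nx by (simp add: t_def field_simps)
      finally show ?thesis .
    qed
    moreover have "hnorm K (?t' \<odot>\<^bsub>K\<^esub> (v1 \<ominus>\<^bsub>K\<^esub> v2)) \<le> C * hnorm H x"
    proof -
      have "hnorm K (?t' \<odot>\<^bsub>K\<^esub> (v1 \<ominus>\<^bsub>K\<^esub> v2)) = (1 / t) * hnorm K (v1 \<ominus>\<^bsub>K\<^esub> v2)"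
        using u t by (simp add: K.hnorm_smult norm_divide)
      also have "\<dots> \<le> (1 / t) * (real n + real n)"
        using K.hnorm_minus_le[of v1 v2] u t 1 2 by (intro mult_left_mono) auto
      also have "\<dots> = C * hnorm H x" using r nx by (simp add: t_def C_def field_simps)
      finally show ?thesis .
    qed
    ultimately show ?thesis by blast
  qed
  \<comment> \<open>The next pair \<open>q\<close> is \<open>p\<close> minus the approximating pair
    \<open>(u, v)\<close>: its first component is the remainder, and the second has changed by
    \<open>v\<close>.\<close>
  have step: "\<exists>q. q \<in> S \<and> hnorm H (fst q) \<le> hnorm H (fst p) / 2
      \<and> hnorm K (snd p \<ominus>\<^bsub>K\<^esub> snd q) \<le> C * hnorm H (fst p)" if pS: "p \<in> S" for p
  proof -
    obtain x y where p: "p = (x, y)" "(x, y) \<in> S" using pS by (cases p) auto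
    obtain u v where uv: "(u, v) \<in> S" "hnorm H (x \<ominus>\<^bsub>H\<^esub> u) \<le> hnorm H x / 2"
      "hnorm K v \<le> C * hnorm H x"
      using approx S_carrier[OF p(2)] by blast
    have "y \<ominus>\<^bsub>K\<^esub> (y \<ominus>\<^bsub>K\<^esub> v) = v"
      using S_carrier[OF p(2)] S_carrier[OF uv(1)] by (intro K.ip_eqI) (simp_all add: K.ip_linear)
    then show ?thesis using S_diff[OF p(2) uv(1)] uv p by force
  qed
  have bound: "hnorm K y0 \<le> 2 * C * hnorm H x0" if S0: "(x0, y0) \<in> S" for x0 y0
  proof -
    obtain p where p: "\<And>i. p i \<in> S" "p 0 = (x0, y0)"
      "\<And>i. hnorm H (fst (p (Suc i))) \<le> hnorm H (fst (p i)) / 2"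
      "\<And>i. hnorm K (snd (p i) \<ominus>\<^bsub>K\<^esub> snd (p (Suc i))) \<le> C * hnorm H (fst (p i))"
    \<comment> \<open>The condition at index 0 fixes the initial pair; membership in
      \<open>S\<close> alone would let the sequence start anywhere.\<close>
    proof (rule exE[OF dependent_nat_choice[of "\<lambda>i p. p \<in> S \<and> (i = 0 \<longrightarrow> p = (x0, y0))"
          "\<lambda>_ p q. hnorm H (fst q) \<le> hnorm H (fst p) / 2
            \<and> hnorm K (snd p \<ominus>\<^bsub>K\<^esub> snd q) \<le> C * hnorm H (fst p)"]])
      show "\<exists>p. p \<in> S \<and> (0 = (0::nat) \<longrightarrow> p = (x0, y0))" using S0 by blast
    next
      fix p and i :: nat assume "p \<in> S \<and> (i = 0 \<longrightarrow> p = (x0, y0))"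
      then show "\<exists>q. (q \<in> S \<and> (Suc i = 0 \<longrightarrow> q = (x0, y0))) \<and> hnorm H (fst q) \<le> hnorm H (fst p) / 2
            \<and> hnorm K (snd p \<ominus>\<^bsub>K\<^esub> snd q) \<le> C * hnorm H (fst p)"
        using step[of p] by auto
    qed (use that in blast)
    define xs where "xs i = fst (p i)" for i
    define ys where "ys i = snd (p i)" for i
    have S_xy: "(xs i, ys i) \<in> S" for i using p(1) by (simp add: xs_def ys_def)
    note xs = S_carrier(1)[OF S_xy] and ys = S_carrier(2)[OF S_xy]
    have xs_le: "hnorm H (xs i) \<le> hnorm H x0 / 2 ^ i" for i
    proof (induction i)
      case (Suc i)
      then show ?case using p(3)[of i] by (simp add: xs_def)
    qed (simp add: xs_def p)
    define D where "D = C * hnorm H x0"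
    have D: "0 \<le> D" using C S_carrier[OF S0] by (simp add: D_def)
    have ys_step: "hnorm K (ys i \<ominus>\<^bsub>K\<^esub> ys (Suc i)) \<le> D / 2 ^ i" for i
    proof -
      have "hnorm K (ys i \<ominus>\<^bsub>K\<^esub> ys (Suc i)) \<le> C * hnorm H (xs i)"
        using p(4) by (simp add: xs_def ys_def)
      also have "\<dots> \<le> C * (hnorm H x0 / 2 ^ i)" using xs_le C by (intro mult_left_mono)
      finally show ?thesis by (simp add: D_def)
    qed
    \<comment> \<open>The right side is the exact geometric sum of the bounds in
      \<open>ys_step\<close>; written as a difference, it telescopes in the induction.\<close>
    have ys_dist: "hnorm K (ys i \<ominus>\<^bsub>K\<^esub> ys (i + k)) \<le> 2 * D / 2 ^ i - 2 * D / 2 ^ (i + k)" for i k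
    proof (induction k)
      case 0
      then show ?case using ys by (simp add: K.minus_eq_zero_iff[THEN iffD2])
    next
      case (Suc k)
      have "ys i \<ominus>\<^bsub>K\<^esub> ys (i + Suc k)
          = (ys i \<ominus>\<^bsub>K\<^esub> ys (i + k)) \<oplus>\<^bsub>K\<^esub> (ys (i + k) \<ominus>\<^bsub>K\<^esub> ys (Suc (i + k)))"
        using ys by (intro K.ip_eqI) (simp_all add: K.ip_linear)
      then have "hnorm K (ys i \<ominus>\<^bsub>K\<^esub> ys (i + Suc k)) \<le> hnorm K (ys i \<ominus>\<^bsub>K\<^esub> ys (i + k))
          + hnorm K (ys (i + k) \<ominus>\<^bsub>K\<^esub> ys (Suc (i + k)))"
        using ys by (simp add: K.hnorm_triangle)
      also have "\<dots> \<le> 2 * D / 2 ^ i - 2 * D / 2 ^ (i + k) + D / 2 ^ (i + k)"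
        using Suc ys_step by (intro add_mono)
      finally show ?case by (simp add: field_simps)
    qed
    have ys_dist_le: "hnorm K (ys i \<ominus>\<^bsub>K\<^esub> ys j) \<le> 2 * D / 2 ^ i" if "i \<le> j" for i j
    proof -
      have "0 \<le> 2 * D / 2 ^ (i + (j - i))" using D by simp
      then show ?thesis using ys_dist[of i "j - i"] that by simp
    qed
    obtain y where y: "y \<in> carrier K" and lim: "(\<lambda>i. hnorm K (ys i \<ominus>\<^bsub>K\<^esub> y)) \<longlonglongrightarrow> 0"
    proof (rule K.Cauchy_converges[of ys])
      fix e :: real assume e: "0 < e"
      have "(\<lambda>i. 2 * D / 2 ^ i) \<longlonglongrightarrow> 0"
        using tendsto_mult_right_zero[OF LIMSEQ_inverse_realpow_zero[of 2], of "2 * D"]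
        by (simp add: divide_inverse power_inverse)
      from order_tendstoD(2)[OF this e] obtain N where N: "2 * D / 2 ^ N < e"
        unfolding eventually_sequentially by blast
      have *: "hnorm K (ys i \<ominus>\<^bsub>K\<^esub> ys j) < e" if "N \<le> i" "i \<le> j" for i j
      proof -
        have "2 * D / 2 ^ i \<le> 2 * D / 2 ^ N"
          using D that by (intro divide_left_mono) (auto intro: power_increasing)
        then show ?thesis using ys_dist_le[OF that(2)] N by linarith
      qed
      have "hnorm K (ys i \<ominus>\<^bsub>K\<^esub> ys j) < e" if "N \<le> i" "N \<le> j" for i j
        using *[of i j] *[of j i] that ys K.hnorm_minus_commute[of "ys i" "ys j"] nat_le_linear[of i j]
        by auto
      then show "\<exists>N. \<forall>i\<ge>N. \<forall>j\<ge>N. hnorm K (ys i \<ominus>\<^bsub>K\<^esub> ys j) < e" by blast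
    qed (use ys that in auto)
    have "(\<lambda>i. hnorm H (xs i)) \<longlonglongrightarrow> 0"
    proof (rule tendsto_sandwich[OF _ _ tendsto_const])
      show "(\<lambda>i. hnorm H x0 / 2 ^ i) \<longlonglongrightarrow> 0"
        using tendsto_mult_right_zero[OF LIMSEQ_inverse_realpow_zero[of 2], of "hnorm H x0"]
        by (simp add: divide_inverse power_inverse)
    qed (use xs xs_le in auto)
    \<comment> \<open>The remainders tend to zero, hence by closedness so do their values. As
      \<open>y0\<close> is \<open>ys 0\<close>, it lies within \<open>2 * D\<close> of arbitrarily
      small vectors.\<close>
    then have "y = \<zero>\<^bsub>K\<^esub>" using closed[OF S_xy _ y lim] by blast
    moreover have "ys i \<ominus>\<^bsub>K\<^esub> \<zero>\<^bsub>K\<^esub> = ys i" for i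
      using ys by (intro K.ip_eqI) (simp_all add: K.ip_linear)
    ultimately have "(\<lambda>i. 2 * D + hnorm K (ys i)) \<longlonglongrightarrow> 2 * D + 0"
      using lim by (intro tendsto_add tendsto_const) simp
    moreover have "hnorm K y0 \<le> 2 * D + hnorm K (ys i)" for i
      using K.hnorm_le_hnorm_minus[of "ys 0" "ys i"] ys_dist_le[of 0 i] ys p(2)
        S_carrier(2)[OF S0] by (simp add: ys_def)
    ultimately have "hnorm K y0 \<le> 2 * D"
      using tendsto_lowerbound[of "\<lambda>i. 2 * D + hnorm K (ys i)" "2 * D" sequentially "hnorm K y0"]
      by simp
    then show ?thesis by (simp add: D_def)
  qed
  then show ?thesis unfolding bounded_relation_def by blast
qed

section \<open>Bounded operators and resolvents\<close>

lemma bounded_opsD: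
  assumes "S \<in> bounded_ops H K"
  shows "linear_relation H K S" "single_valued S" "Domain S = carrier H" "bounded_relation H K S"
  using assms by (auto simp: bounded_ops_def)

text \<open>Condition (iii) speaks of the adjoint of the \<gamma>-field; this recovers the
  \<gamma>-field itself as part of an operator of the ideal. Every \<open>g\<close> has an image
  \<open>g'\<close> under the common adjoint, so the values of \<open>R\<close> and \<open>S\<close>
  at \<open>x\<close> have the same inner product with every \<open>g\<close>.\<close>

lemma bounded_op_extends:
  assumes H: "hilbert_space H" and K: "cinner_space K" and S: "S \<in> bounded_ops H K"
    and R: "R \<subseteq> carrier H \<times> carrier K" and adj: "rel_adj H K R = rel_adj H K S"
  shows "R \<subseteq> S"
proof clarify
  interpret K: cinner_space K by fact
  fix x y assume xy: "(x, y) \<in> R"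
  then obtain v where v: "(x, v) \<in> S" using R bounded_opsD(3)[OF S] by blast
  have "y = v"
  proof (rule K.ip_eqI)
    fix g assume "g \<in> carrier K"
    then obtain g' where g': "(g, g') \<in> rel_adj H K S" using bounded_op_adjoint[OF H K S] by blast
    then have "ip K y g = ip H x g'" using xy adj unfolding rel_adj_def by blast
    also have "\<dots> = ip K v g" using v g' unfolding rel_adj_def by auto
    finally show "ip K y g = ip K v g" .
  qed (use xy R v linear_relation_carrier[OF bounded_opsD(1)[OF S]] in blast)+
  then show "(x, y) \<in> S" using v by simp
qed

section \<open>Operators of the form \<open>I + c R\<close>, and resolvents of relations\<close>

context cinner_space
begin

lemma Id_on_bounded_op: "Id_on (carrier H) \<in> bounded_ops H H"
proof -
  have "bounded_relation H H (Id_on (carrier H))"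
    unfolding bounded_relation_def by (rule exI[of _ 1]) auto
  then show ?thesis by (auto simp: bounded_ops_def linear_relation_def)
qed

text \<open>Supplies the bounded factor \<open>I + (z - \<nu>) (A\<^sub>0 - z)\<inverse>\<close>
  that carries the \<gamma>-field from \<open>\<nu>\<close> to \<open>z\<close>.\<close>

lemma id_plus_smult_bounded_op:
  assumes R: "R \<in> bounded_ops H H"
  shows "{(x, x \<oplus> c \<odot> y) | x y. (x, y) \<in> R} \<in> bounded_ops H H"
proof -
  note lin = bounded_opsD(1)[OF R]
  note R_carrier = linear_relation_carrier[OF lin]
  obtain b where b: "\<And>x y. (x, y) \<in> R \<Longrightarrow> hnorm H y \<le> b * hnorm H x"
    using bounded_relationE[OF bounded_opsD(4)[OF R]] by metis
  have "linear_relation H H {(x, x \<oplus> c \<odot> y) | x y. (x, y) \<in> R}" (is "linear_relation H H ?C")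
    unfolding linear_relation_def
  proof (intro conjI allI impI)
    show "?C \<subseteq> carrier H \<times> carrier H" using R_carrier by auto
    have "(\<zero>, \<zero>) \<in> R" using lin by (simp add: linear_relation_def)
    moreover have "\<zero> = \<zero> \<oplus> c \<odot> \<zero>" by (rule ip_eqI) (simp_all add: ip_linear)
    ultimately show "(\<zero>, \<zero>) \<in> ?C" by blast
  next
    fix x x' y y' assume "(x, x') \<in> ?C" "(y, y') \<in> ?C"
    then obtain u v where uv: "(x, u) \<in> R" "x' = x \<oplus> c \<odot> u" "(y, v) \<in> R" "y' = y \<oplus> c \<odot> v" by blast
    have "x' \<oplus> y' = (x \<oplus> y) \<oplus> c \<odot> (u \<oplus> v)"
      using uv(2,4) R_carrier[OF uv(1)] R_carrier[OF uv(3)]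
      by (intro ip_eqI) (simp_all add: ip_linear algebra_simps)
    then show "(x \<oplus> y, x' \<oplus> y') \<in> ?C" using linear_relation_add[OF lin uv(1,3)] by blast
  next
    fix a x x' assume "(x, x') \<in> ?C"
    then obtain u where u: "(x, u) \<in> R" "x' = x \<oplus> c \<odot> u" by blast
    have "a \<odot> x' = a \<odot> x \<oplus> c \<odot> (a \<odot> u)"
      using u(2) R_carrier[OF u(1)] by (intro ip_eqI) (simp_all add: ip_linear algebra_simps)
    then show "(a \<odot> x, a \<odot> x') \<in> ?C" using linear_relation_smult[OF lin u(1)] by blast
  qed
  moreover have "single_valued ?C"
    using bounded_opsD(2)[OF R] by (auto simp: single_valued_def)
  moreover have "Domain ?C = carrier H"
    unfolding bounded_opsD(3)[OF R, symmetric] by blast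
  moreover have "bounded_relation H H ?C"
    unfolding bounded_relation_def
  proof (intro exI[of _ "1 + cmod c * b"] ballI, clarify)
    fix x y assume xy: "(x, y) \<in> R"
    have "hnorm H (x \<oplus> c \<odot> y) \<le> hnorm H x + cmod c * hnorm H y"
      using hnorm_triangle[of x "c \<odot> y"] R_carrier[OF xy] by (simp add: hnorm_smult)
    also have "\<dots> \<le> hnorm H x + cmod c * (b * hnorm H x)"
      using b[OF xy] by (intro add_left_mono mult_left_mono) auto
    finally show "hnorm H (x \<oplus> c \<odot> y) \<le> (1 + cmod c * b) * hnorm H x"
      by (simp add: algebra_simps)
  qed
  ultimately show ?thesis by (simp add: bounded_ops_def)
qed

text \<open>The right-hand form is the one to which the boundary maps and the linear structure of
  \<open>S\<close> apply.\<close>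

lemma resolvent_iff:
  assumes "linear_relation H H S" "h \<in> carrier H"
  shows "(h, f) \<in> (rel_shift H S z)\<inverse> \<longleftrightarrow> (f, h \<oplus> z \<odot> f) \<in> S"
proof
  assume "(h, f) \<in> (rel_shift H S z)\<inverse>"
  then obtain f' where f': "(f, f') \<in> S" "h = f' \<ominus> z \<odot> f" by (auto simp: rel_shift_def)
  then show "(f, h \<oplus> z \<odot> f) \<in> S"
    using linear_relation_carrier[OF assms(1) f'(1)] by (simp add: minus_add_cancel)
next
  assume f: "(f, h \<oplus> z \<odot> f) \<in> S"
  have "h = (h \<oplus> z \<odot> f) \<ominus> z \<odot> f"
    using linear_relation_carrier[OF assms(1) f] assms(2)
    by (intro ip_eqI) (simp_all add: ip_linear)
  then show "(h, f) \<in> (rel_shift H S z)\<inverse>" using f unfolding rel_shift_def by blast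
qed

lemma resolvent_solve:
  assumes "linear_relation H H S" "z \<in> resolvent_set H S" "h \<in> carrier H"
  obtains f where "(f, h \<oplus> z \<odot> f) \<in> S"
proof -
  obtain f where "(h, f) \<in> (rel_shift H S z)\<inverse>"
    using bounded_opsD(3) assms(2,3) unfolding resolvent_set_def by blast
  then show thesis using that resolvent_iff[OF assms(1,3)] by blast
qed

lemma resolvent_unique:
  assumes "z \<in> resolvent_set H S" "(h, f) \<in> (rel_shift H S z)\<inverse>" "(h, g) \<in> (rel_shift H S z)\<inverse>"
  shows "f = g"
  using single_valuedD[OF bounded_opsD(2)] assms unfolding resolvent_set_def by (metis mem_Collect_eq)

end

text \<open>The solution \<open>u\<close> is the image of \<open>h\<close> under the adjoint of the
  bounded operator \<open>(S - z)\<inverse>\<close>; testing against elements of \<open>S\<close>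
  puts \<open>(u, h + cnj z u)\<close> into the adjoint of \<open>S\<close>, which is
  \<open>S\<close>. Later this moves elements of \<open>T\<close> into the kernel of
  \<open>T - cnj z\<close>.\<close>

lemma (in hilbert_space) selfadjoint_solve_cnj:
  assumes S: "selfadjoint_relation H S" and z: "z \<in> resolvent_set H S" and h: "h \<in> carrier H"
  obtains f where "(f, h \<oplus> cnj z \<odot> f) \<in> S"
proof -
  have lin: "linear_relation H H S" and adj: "S = rel_adj H H S"
    using S by (auto simp: selfadjoint_relation_def)
  obtain u where u: "(h, u) \<in> rel_adj H H ((rel_shift H S z)\<inverse>)"
    using bounded_op_adjoint[OF hilbert_space_axioms cinner_space_axioms _ h] z
    unfolding resolvent_set_def by blast
  then have uc: "u \<in> carrier H" by (simp add: rel_adj_def)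
  have "(u, h \<oplus> cnj z \<odot> u) \<in> rel_adj H H S"
    unfolding rel_adj_def
  proof (clarsimp simp: uc h)
    fix f f' assume f: "(f, f') \<in> S"
    note fc = linear_relation_carrier[OF lin f]
    have "(f' \<ominus> z \<odot> f, f) \<in> (rel_shift H S z)\<inverse>" using f unfolding rel_shift_def by blast
    then have "ip H f h = ip H (f' \<ominus> z \<odot> f) u" using u unfolding rel_adj_def by blast
    then show "ip H f' u = ip H f (h \<oplus> cnj z \<odot> u)" using fc uc h by (simp add: ip_linear)
  qed
  then show thesis using that adj by blast
qed

section \<open>Resolvent differences\<close>

lemma linear_map_onD:
  assumes "linear_map_on H T G \<Gamma>"
  shows "(f, f') \<in> T \<Longrightarrow> \<Gamma> (f, f') \<in> carrier G"
    and "\<lbrakk>(f, f') \<in> T; (g, g') \<in> T\<rbrakk> \<Longrightarrow>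
      \<Gamma> (f \<oplus>\<^bsub>H\<^esub> g, f' \<oplus>\<^bsub>H\<^esub> g') = \<Gamma> (f, f') \<oplus>\<^bsub>G\<^esub> \<Gamma> (g, g')"
    and "(f, f') \<in> T \<Longrightarrow> \<Gamma> (c \<odot>\<^bsub>H\<^esub> f, c \<odot>\<^bsub>H\<^esub> f') = c \<odot>\<^bsub>G\<^esub> \<Gamma> (f, f')"
proof -
  note \<Gamma> = assms[unfolded linear_map_on_def]
  show "(f, f') \<in> T \<Longrightarrow> \<Gamma> (f, f') \<in> carrier G" using \<Gamma> by blast
  show "\<lbrakk>(f, f') \<in> T; (g, g') \<in> T\<rbrakk> \<Longrightarrow>
      \<Gamma> (f \<oplus>\<^bsub>H\<^esub> g, f' \<oplus>\<^bsub>H\<^esub> g') = \<Gamma> (f, f') \<oplus>\<^bsub>G\<^esub> \<Gamma> (g, g')"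
    using \<Gamma> by simp
  show "(f, f') \<in> T \<Longrightarrow> \<Gamma> (c \<odot>\<^bsub>H\<^esub> f, c \<odot>\<^bsub>H\<^esub> f') = c \<odot>\<^bsub>G\<^esub> \<Gamma> (f, f')"
    using \<Gamma> by simp
qed

lemma (in cinner_space) linear_map_on_diff:
  assumes G: "cinner_space G" and T: "linear_relation H H T" and \<Gamma>: "linear_map_on H T G \<Gamma>"
    and f: "(f, f') \<in> T" and g: "(g, g') \<in> T"
  shows "\<Gamma> (f \<ominus> g, f' \<ominus> g') = \<Gamma> (f, f') \<ominus>\<^bsub>G\<^esub> \<Gamma> (g, g')"
proof -
  interpret G: cinner_space G by fact
  have "\<Gamma> (f \<oplus> (- 1) \<odot> g, f' \<oplus> (- 1) \<odot> g') = \<Gamma> (f, f') \<oplus>\<^bsub>G\<^esub> (- 1) \<odot>\<^bsub>G\<^esub> \<Gamma> (g, g')"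
    using linear_map_onD[OF \<Gamma>] linear_relation_smult[OF T g] f g by metis
  then show ?thesis
    using linear_relation_carrier[OF T f] linear_relation_carrier[OF T g] linear_map_onD(1)[OF \<Gamma>] f g
    by (simp add: minus_conv_add G.minus_conv_add)
qed

text \<open>\<open>L\<close> is a record with its own operations, on which an inclusion of carriers
  says nothing; linearity of the identity embedding forces them to agree with those of
  \<open>G\<close>.\<close>

lemma embedding_ops:
  assumes L: "cinner_space L" and G: "cinner_space G"
    and lin: "linear_relation L G (Id_on (carrier L))"
    and x: "x \<in> carrier L" and y: "y \<in> carrier L"
  shows "x \<oplus>\<^bsub>L\<^esub> y = x \<oplus>\<^bsub>G\<^esub> y" "c \<odot>\<^bsub>L\<^esub> x = c \<odot>\<^bsub>G\<^esub> x" "x \<ominus>\<^bsub>L\<^esub> y = x \<ominus>\<^bsub>G\<^esub> y"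
proof -
  interpret L: cinner_space L by fact
  have I: "(x, x) \<in> Id_on (carrier L)" "(y, y) \<in> Id_on (carrier L)" using x y by auto
  show "x \<oplus>\<^bsub>L\<^esub> y = x \<oplus>\<^bsub>G\<^esub> y" using linear_relation_add[OF lin I] by auto
  show "c \<odot>\<^bsub>L\<^esub> x = c \<odot>\<^bsub>G\<^esub> x" using linear_relation_smult[OF lin I(1), of c] by (elim Id_onE) simp
  show "x \<ominus>\<^bsub>L\<^esub> y = x \<ominus>\<^bsub>G\<^esub> y" using L.linear_relation_diff[OF G lin I] by auto
qed

section \<open>Factorisation of the resolvent difference through the boundary space\<close>

context quasi_boundary_triple
begin

lemma T_carrier: "(f, f') \<in> T \<Longrightarrow> f \<in> carrier H \<and> f' \<in> carrier H"
  using linear_relation_carrier[OF T_linear] by blast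

lemmas \<Gamma>0_simps = linear_map_onD[OF \<Gamma>0_linear]
  and \<Gamma>1_simps = linear_map_onD[OF \<Gamma>1_linear]
  and \<Gamma>0_diff = H.linear_map_on_diff[OF G.cinner_space_axioms T_linear \<Gamma>0_linear]
  and \<Gamma>1_diff = H.linear_map_on_diff[OF G.cinner_space_axioms T_linear \<Gamma>1_linear]
  and T_diff = H.linear_relation_diff[OF H.cinner_space_axioms T_linear]

text \<open>The joint range meets the open box \<open>carrier G \<times> M.mball z e\<close>, whose
  full first factor leaves the value of \<open>\<Gamma>0\<close> free.\<close>

lemma range_\<Gamma>1_dense:
  assumes z: "z \<in> carrier G" and e: "0 < e"
  obtains f f' where "(f, f') \<in> T" "hnorm G (z \<ominus>\<^bsub>G\<^esub> \<Gamma>1 (f, f')) < e"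
proof -
  interpret M: Metric_space "carrier G" "hdist G" by (rule G.Metric_space_hdist)
  have op: "openin (prod_topology (htop G) (htop G)) (carrier G \<times> M.mball z e)"
    using openin_topspace[of M.mtopology] by (simp add: htop_def openin_prod_Times_iff)
  have mem: "(\<zero>\<^bsub>G\<^esub>, z) \<in> carrier G \<times> M.mball z e" using z e by simp
  have "(\<zero>\<^bsub>G\<^esub>, z) \<in> prod_topology (htop G) (htop G) closure_of ((\<lambda>f. (\<Gamma>0 f, \<Gamma>1 f)) ` T)"
    using z by (simp add: dense_range)
  from this[unfolded in_closure_of, THEN conjunct2, rule_format, OF conjI, OF mem op]
  obtain f where "f \<in> T" "\<Gamma>1 f \<in> M.mball z e" by blast
  then show thesis using that[of "fst f" "snd f"] z by (simp add: hdist_def split: if_splits)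
qed

text \<open>This is the operator \<open>M(z)\<inverse> \<gamma>(cnj z)\<^sup>*\<close> up to sign. By Green's identity its adjoint is defined
  on \<open>ran M(cnj z) = ran \<Gamma>1\<close>; since this is dense in \<open>G\<close>, the closed graph theorem applies also for
  the finer norm of \<open>L\<close>.\<close>

lemma boundary_value_bounded_op:
  assumes A1: "selfadjoint_relation H (boundary_ker G T \<Gamma>1)"
    and z: "z \<in> resolvent_set H (boundary_ker G T \<Gamma>1)"
    and L: "hilbert_space L" and ran: "\<Gamma>0 ` T \<subseteq> carrier L"
    and emb: "Id_on (carrier L) \<in> bounded_ops L G"
  shows "{(f' \<ominus>\<^bsub>H\<^esub> z \<odot>\<^bsub>H\<^esub> f, \<Gamma>0 (f, f')) | f f'. (f, f') \<in> boundary_ker G T \<Gamma>1} \<in> bounded_ops H L"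
    (is "?K \<in> _")
proof -
  interpret L: hilbert_space L by fact
  let ?A1 = "boundary_ker G T \<Gamma>1"
  have A1_lin: "linear_relation H H ?A1" using A1 by (simp add: selfadjoint_relation_def)
  have A1D: "(f, f') \<in> T" "\<Gamma>1 (f, f') = \<zero>\<^bsub>G\<^esub>" "f \<in> carrier H" "f' \<in> carrier H" "\<Gamma>0 (f, f') \<in> carrier L"
    if "(f, f') \<in> ?A1" for f f'
    using that ran T_carrier by (auto simp: boundary_ker_def)
  note emb_lin = bounded_opsD(1)[OF emb]
  note L_ops = embedding_ops[OF L.cinner_space_axioms G.cinner_space_axioms emb_lin]
  have L_G: "x \<in> carrier G" if "x \<in> carrier L" for x
    using linear_relation_carrier(2)[OF emb_lin, of x x] that by auto
  obtain b where b: "\<And>x. x \<in> carrier L \<Longrightarrow> hnorm G x \<le> b * hnorm L x"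
    using bounded_relationE[OF bounded_opsD(4)[OF emb]]
    by (metis Id_onI)
  \<comment> \<open>Proved ahead of the other linearity conditions because the zero pair is obtained
    from it, as 0 times some element of \<open>?K\<close>; \<open>linear_map_on\<close> has no
    separate clause for zero.\<close>
  have smult: "(c \<odot>\<^bsub>H\<^esub> h, c \<odot>\<^bsub>L\<^esub> k) \<in> ?K" if hk: "(h, k) \<in> ?K" for c h k
  proof -
    obtain f f' where f: "(f, f') \<in> ?A1" "h = f' \<ominus>\<^bsub>H\<^esub> z \<odot>\<^bsub>H\<^esub> f" "k = \<Gamma>0 (f, f')"
      using hk by blast
    note D = A1D[OF f(1)]
    have "c \<odot>\<^bsub>H\<^esub> h = c \<odot>\<^bsub>H\<^esub> f' \<ominus>\<^bsub>H\<^esub> z \<odot>\<^bsub>H\<^esub> (c \<odot>\<^bsub>H\<^esub> f)"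
      using f(2) D by (intro H.ip_eqI) (simp_all add: H.ip_linear algebra_simps)
    moreover have "c \<odot>\<^bsub>L\<^esub> k = \<Gamma>0 (c \<odot>\<^bsub>H\<^esub> f, c \<odot>\<^bsub>H\<^esub> f')"
      using f(3) D L_ops(2) by (simp add: \<Gamma>0_simps)
    ultimately show ?thesis using linear_relation_smult[OF A1_lin f(1)] by blast
  qed
  have lin: "linear_relation H L ?K"
    unfolding linear_relation_def
  proof (intro conjI allI impI smult)
    show K_sub: "?K \<subseteq> carrier H \<times> carrier L" using A1D by auto
    have "(\<zero>\<^bsub>H\<^esub>, \<zero>\<^bsub>H\<^esub>) \<in> ?A1" using A1_lin by (simp add: linear_relation_def)
    then obtain h k where hk: "(h, k) \<in> ?K" by blast
    then have "h \<in> carrier H" "k \<in> carrier L" using K_sub by auto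
    then have "0 \<odot>\<^bsub>H\<^esub> h = \<zero>\<^bsub>H\<^esub>" "0 \<odot>\<^bsub>L\<^esub> k = \<zero>\<^bsub>L\<^esub>"
      using H.smult_l_null[of h] L.smult_l_null[of k] by simp_all
    then show "(\<zero>\<^bsub>H\<^esub>, \<zero>\<^bsub>L\<^esub>) \<in> ?K" using smult[OF hk, of 0] by simp
  next
    fix h k h' k' assume "(h, k) \<in> ?K" "(h', k') \<in> ?K"
    then obtain f f' g g' where f: "(f, f') \<in> ?A1" "h = f' \<ominus>\<^bsub>H\<^esub> z \<odot>\<^bsub>H\<^esub> f" "k = \<Gamma>0 (f, f')"
      and g: "(g, g') \<in> ?A1" "h' = g' \<ominus>\<^bsub>H\<^esub> z \<odot>\<^bsub>H\<^esub> g" "k' = \<Gamma>0 (g, g')" by blast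
    note D = A1D[OF f(1)] A1D[OF g(1)]
    have "h \<oplus>\<^bsub>H\<^esub> h' = (f' \<oplus>\<^bsub>H\<^esub> g') \<ominus>\<^bsub>H\<^esub> z \<odot>\<^bsub>H\<^esub> (f \<oplus>\<^bsub>H\<^esub> g)"
      using f(2) g(2) D by (intro H.ip_eqI) (simp_all add: H.ip_linear algebra_simps)
    moreover have "k \<oplus>\<^bsub>L\<^esub> k' = \<Gamma>0 (f \<oplus>\<^bsub>H\<^esub> g, f' \<oplus>\<^bsub>H\<^esub> g')"
      using f(3) g(3) D L_ops(1) by (simp add: \<Gamma>0_simps)
    ultimately show "(h \<oplus>\<^bsub>H\<^esub> h', k \<oplus>\<^bsub>L\<^esub> k') \<in> ?K"
      using linear_relation_add[OF A1_lin f(1) g(1)] by blast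
  qed
  moreover have "single_valued ?K"
  proof (rule single_valuedI)
    fix h k k' assume "(h, k) \<in> ?K" "(h, k') \<in> ?K"
    then obtain f f' g g' where f: "(f, f') \<in> ?A1" "h = f' \<ominus>\<^bsub>H\<^esub> z \<odot>\<^bsub>H\<^esub> f" "k = \<Gamma>0 (f, f')"
      and g: "(g, g') \<in> ?A1" "h = g' \<ominus>\<^bsub>H\<^esub> z \<odot>\<^bsub>H\<^esub> g" "k' = \<Gamma>0 (g, g')" by blast
    note D = A1D[OF f(1)] A1D[OF g(1)]
    have "(h, f) \<in> (rel_shift H ?A1 z)\<inverse>" "(h, g) \<in> (rel_shift H ?A1 z)\<inverse>"
      using f g unfolding rel_shift_def by blast+
    then have "f = g" by (rule H.resolvent_unique[OF z])
    moreover have "f' = h \<oplus>\<^bsub>H\<^esub> z \<odot>\<^bsub>H\<^esub> f" "g' = h \<oplus>\<^bsub>H\<^esub> z \<odot>\<^bsub>H\<^esub> g"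
      using D by (simp_all add: f(2) H.minus_add_cancel) (simp add: f(2)[symmetric] g(2) H.minus_add_cancel)
    ultimately show "k = k'" using f g by simp
  qed
  moreover have dom: "Domain ?K = carrier H"
  proof (rule antisym)
    show "Domain ?K \<subseteq> carrier H" using linear_relation_carrier[OF lin] by blast
    show "carrier H \<subseteq> Domain ?K"
    proof
      fix h assume h: "h \<in> carrier H"
      obtain f where f: "(f, h \<oplus>\<^bsub>H\<^esub> z \<odot>\<^bsub>H\<^esub> f) \<in> ?A1"
        using H.resolvent_solve[OF A1_lin z h] by blast
      have "h = (h \<oplus>\<^bsub>H\<^esub> z \<odot>\<^bsub>H\<^esub> f) \<ominus>\<^bsub>H\<^esub> z \<odot>\<^bsub>H\<^esub> f"
        using A1D[OF f] h by (intro H.ip_eqI) (simp_all add: H.ip_linear)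
      then have "(h, \<Gamma>0 (f, h \<oplus>\<^bsub>H\<^esub> z \<odot>\<^bsub>H\<^esub> f)) \<in> ?K" using f by blast
      then show "h \<in> Domain ?K" by blast
    qed
  qed
  moreover have "bounded_relation H L ?K"
  proof (rule closed_graph[OF H.hilbert_space_axioms L lin dom])
    fix hs ks k
    assume hk: "\<And>n :: nat. (hs n, ks n) \<in> ?K" and hs_lim: "(\<lambda>n. hnorm H (hs n)) \<longlonglongrightarrow> 0"
      and k: "k \<in> carrier L" and ks_lim: "(\<lambda>n. hnorm L (ks n \<ominus>\<^bsub>L\<^esub> k)) \<longlonglongrightarrow> 0"
    note hks = linear_relation_carrier[OF lin hk]
    \<comment> \<open>Boundedness of the embedding moves the limit from \<open>L\<close> to
      \<open>G\<close>, where Green's identity and the density of the range of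
      \<open>\<Gamma>1\<close> are available.\<close>
    have ks_lim_G: "(\<lambda>n. hnorm G (ks n \<ominus>\<^bsub>G\<^esub> k)) \<longlonglongrightarrow> 0"
    proof (rule tendsto_sandwich[OF _ _ tendsto_const])
      show "(\<lambda>n. b * hnorm L (ks n \<ominus>\<^bsub>L\<^esub> k)) \<longlonglongrightarrow> 0" using tendsto_mult_right_zero[OF ks_lim] .
      show "\<forall>\<^sub>F n in sequentially. hnorm G (ks n \<ominus>\<^bsub>G\<^esub> k) \<le> b * hnorm L (ks n \<ominus>\<^bsub>L\<^esub> k)"
      proof (rule always_eventually, rule allI)
        fix n
        have "ks n \<ominus>\<^bsub>L\<^esub> k \<in> carrier L" using hks k by simp
        from b[OF this] show "hnorm G (ks n \<ominus>\<^bsub>G\<^esub> k) \<le> b * hnorm L (ks n \<ominus>\<^bsub>L\<^esub> k)"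
          by (simp only: L_ops(3)[OF hks(2) k])
      qed
      show "\<forall>\<^sub>F n in sequentially. 0 \<le> hnorm G (ks n \<ominus>\<^bsub>G\<^esub> k)"
        using L_G hks k by simp
    qed
    have "k = \<zero>\<^bsub>G\<^esub>"
    proof (rule G.Re_ip_eqI)
      fix w assume "w \<in> \<Gamma>1 ` T"
      then obtain u u' where u: "(u, u') \<in> T" "w = \<Gamma>1 (u, u')" by auto
      note uc = T_carrier[OF u(1)]
      have "u' \<ominus>\<^bsub>H\<^esub> cnj z \<odot>\<^bsub>H\<^esub> u \<in> carrier H" using uc by simp
      \<comment> \<open>Here \<open>f\<close> solves \<open>(A1 - cnj z) f = u' - cnj z u\<close>.
        Subtracting it puts \<open>g = u - f\<close> into the kernel of \<open>T - cnj z\<close> and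
        keeps the value \<open>w\<close>, since \<open>\<Gamma>1\<close> vanishes on
        \<open>A1\<close>.\<close>
      then obtain f where f: "(f, (u' \<ominus>\<^bsub>H\<^esub> cnj z \<odot>\<^bsub>H\<^esub> u) \<oplus>\<^bsub>H\<^esub> cnj z \<odot>\<^bsub>H\<^esub> f) \<in> ?A1" (is "(f, ?f') \<in> _")
        using H.selfadjoint_solve_cnj[OF A1 z] by blast
      define g where "g = u \<ominus>\<^bsub>H\<^esub> f"
      have fc: "f \<in> carrier H" using A1D[OF f] by simp
      have gc: "g \<in> carrier H" using uc fc by (simp add: g_def)
      have "u' \<ominus>\<^bsub>H\<^esub> ?f' = cnj z \<odot>\<^bsub>H\<^esub> g"
        unfolding g_def using uc fc by (intro H.ip_eqI) (simp_all add: H.ip_linear algebra_simps)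
      then have gT: "(g, cnj z \<odot>\<^bsub>H\<^esub> g) \<in> T" and "\<Gamma>1 (g, cnj z \<odot>\<^bsub>H\<^esub> g) = w \<ominus>\<^bsub>G\<^esub> \<zero>\<^bsub>G\<^esub>"
        using T_diff[OF u(1) A1D(1)[OF f]] \<Gamma>1_diff[OF u(1) A1D(1)[OF f]] u(2) A1D(2)[OF f]
        by (simp_all add: g_def)
      moreover have wc: "w \<in> carrier G" using u \<Gamma>1_simps(1) by simp
      moreover have "w \<ominus>\<^bsub>G\<^esub> \<zero>\<^bsub>G\<^esub> = w" using wc by (intro G.ip_eqI) (simp_all add: G.ip_linear)
      ultimately have w: "w = \<Gamma>1 (g, cnj z \<odot>\<^bsub>H\<^esub> g)" by simp
      \<comment> \<open>Green's identity for \<open>(v, v')\<close> and \<open>g\<close>, where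
        \<open>\<Gamma>1\<close> vanishes on the first pair; the left side
        \<open>(v', g) - (v, cnj z g)\<close> equals
        \<open>(v' - z v, g) = (hs n, g)\<close>.\<close>
      have ip: "ip G (ks n) w = - ip H (hs n) g" for n
      proof -
        obtain v v' where v: "(v, v') \<in> ?A1" "hs n = v' \<ominus>\<^bsub>H\<^esub> z \<odot>\<^bsub>H\<^esub> v" "ks n = \<Gamma>0 (v, v')"
          using hk[of n] by blast
        note D = A1D[OF v(1)]
        have "ip H v' g - ip H v (cnj z \<odot>\<^bsub>H\<^esub> g) = - ip G (ks n) w"
          using Green[OF D(1) gT] D(2) v(3) w \<Gamma>0_simps(1)[OF gT] by simp
        then show ?thesis using v(2) D gc by (simp add: H.ip_linear)
      qed
      have "(\<lambda>n. Re (ip H (hs n) g)) \<longlonglongrightarrow> Re (ip H \<zero>\<^bsub>H\<^esub> g)"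
      proof (rule H.Re_ip_tendsto)
        have "hs n \<ominus>\<^bsub>H\<^esub> \<zero>\<^bsub>H\<^esub> = hs n" for n
          using hks by (intro H.ip_eqI) (simp_all add: H.ip_linear)
        then show "(\<lambda>n. hnorm H (hs n \<ominus>\<^bsub>H\<^esub> \<zero>\<^bsub>H\<^esub>)) \<longlonglongrightarrow> 0" using hs_lim by simp
      qed (use hks gc in auto)
      then have "(\<lambda>n. Re (ip G (ks n) w)) \<longlonglongrightarrow> 0" using tendsto_minus gc by (fastforce simp: ip)
      moreover have "(\<lambda>n. Re (ip G (ks n) w)) \<longlonglongrightarrow> Re (ip G k w)"
        using L_G hks k wc ks_lim_G by (intro G.Re_ip_tendsto) auto
      ultimately have "Re (ip G k w) = 0" using LIMSEQ_unique by blast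
      then show "Re (ip G k w) = Re (ip G \<zero>\<^bsub>G\<^esub> w)" using wc by simp
    next
      fix y and e :: real assume "y \<in> carrier G" "0 < e"
      then obtain f f' where "(f, f') \<in> T" "hnorm G (y \<ominus>\<^bsub>G\<^esub> \<Gamma>1 (f, f')) < e"
        by (rule range_\<Gamma>1_dense)
      then show "\<exists>d \<in> \<Gamma>1 ` T \<inter> carrier G. hnorm G (y \<ominus>\<^bsub>G\<^esub> d) < e"
        using \<Gamma>1_simps(1) by blast
    qed (use L_G k in auto)
    moreover have "\<zero>\<^bsub>L\<^esub> = \<zero>\<^bsub>G\<^esub>" using emb_lin by (auto simp: linear_relation_def)
    ultimately show "k = \<zero>\<^bsub>L\<^esub>" by simp
  qed
  ultimately show ?thesis unfolding bounded_ops_def by blast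
qed

text \<open>In operator notation, \<open>\<gamma>(z) = (I + (z - \<nu>) (A\<^sub>0 - z)\<inverse>) \<gamma>(\<nu>)\<close>.\<close>

lemma gamma_field_shift:
  assumes z: "z \<in> resolvent_set H (boundary_ker G T \<Gamma>0)"
    and \<nu>: "\<nu> \<in> resolvent_set H (boundary_ker G T \<Gamma>0)"
    and d: "(d, z \<odot>\<^bsub>H\<^esub> d) \<in> T"
  shows "\<exists>e r. (\<Gamma>0 (d, z \<odot>\<^bsub>H\<^esub> d), e) \<in> gamma_field H T \<Gamma>0 \<nu> \<and>
    (e, r) \<in> (rel_shift H (boundary_ker G T \<Gamma>0) z)\<inverse> \<and> d = e \<oplus>\<^bsub>H\<^esub> (z - \<nu>) \<odot>\<^bsub>H\<^esub> r"
proof -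
  let ?A0 = "boundary_ker G T \<Gamma>0"
  have A0_lin: "linear_relation H H ?A0" using A0_selfadjoint by (simp add: selfadjoint_relation_def)
  have dc: "d \<in> carrier H" using T_carrier[OF d] by simp
  then have "(\<nu> - z) \<odot>\<^bsub>H\<^esub> d \<in> carrier H" by simp
  \<comment> \<open>This is \<open>x = (\<nu> - z) (A\<^sub>0 - \<nu>)\<inverse> d\<close>, chosen
    so that \<open>d + x\<close> lies in the kernel of \<open>T - \<nu>\<close>; the boundary value
    of \<open>d\<close> is kept because \<open>\<Gamma>0\<close> vanishes on
    \<open>A\<^sub>0\<close>.\<close>
  then obtain x where x: "(x, (\<nu> - z) \<odot>\<^bsub>H\<^esub> d \<oplus>\<^bsub>H\<^esub> \<nu> \<odot>\<^bsub>H\<^esub> x) \<in> ?A0" (is "(x, ?x') \<in> _")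
    using H.resolvent_solve[OF A0_lin \<nu>] by blast
  then have xT: "(x, ?x') \<in> T" and x0: "\<Gamma>0 (x, ?x') = \<zero>\<^bsub>G\<^esub>" by (auto simp: boundary_ker_def)
  have xc: "x \<in> carrier H" using T_carrier[OF xT] by simp
  define e where "e = d \<oplus>\<^bsub>H\<^esub> x"
  have ec: "e \<in> carrier H" using dc xc by (simp add: e_def)
  have sum: "z \<odot>\<^bsub>H\<^esub> d \<oplus>\<^bsub>H\<^esub> ?x' = \<nu> \<odot>\<^bsub>H\<^esub> e"
    unfolding e_def using dc xc by (intro H.ip_eqI) (simp_all add: H.ip_linear algebra_simps)
  have eT: "(e, \<nu> \<odot>\<^bsub>H\<^esub> e) \<in> T"
    using linear_relation_add[OF T_linear d xT] sum by (simp add: e_def)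
  have e0: "\<Gamma>0 (e, \<nu> \<odot>\<^bsub>H\<^esub> e) = \<Gamma>0 (d, z \<odot>\<^bsub>H\<^esub> d)"
    using \<Gamma>0_simps(2)[OF d xT] sum x0 \<Gamma>0_simps(1)[OF d] by (simp add: e_def)
  have "\<nu> \<odot>\<^bsub>H\<^esub> e \<ominus>\<^bsub>H\<^esub> \<nu> \<odot>\<^bsub>H\<^esub> e = \<zero>\<^bsub>H\<^esub>" using ec by (simp add: H.minus_eq_zero_iff)
  then have "e \<in> rel_ker H (rel_shift H T \<nu>)"
    using eT unfolding rel_ker_def rel_shift_def by (auto intro!: exI)
  then have "(e, \<nu> \<odot>\<^bsub>H\<^esub> e) \<in> defect_rel H T \<nu>" by (auto simp: defect_rel_def)
  then have "(\<Gamma>0 (e, \<nu> \<odot>\<^bsub>H\<^esub> e), fst (e, \<nu> \<odot>\<^bsub>H\<^esub> e)) \<in> gamma_field H T \<Gamma>0 \<nu>"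
    unfolding gamma_field_def by blast
  then have gamma: "(\<Gamma>0 (d, z \<odot>\<^bsub>H\<^esub> d), e) \<in> gamma_field H T \<Gamma>0 \<nu>" by (simp add: e0)
  obtain r where r: "(r, e \<oplus>\<^bsub>H\<^esub> z \<odot>\<^bsub>H\<^esub> r) \<in> ?A0" using H.resolvent_solve[OF A0_lin z ec] by blast
  have rc: "r \<in> carrier H" using linear_relation_carrier[OF A0_lin r] by simp
  \<comment> \<open>A form of the resolvent identity: both sides are the image of
    \<open>(\<nu> - z) e\<close> under the resolvent of \<open>?A0\<close> at
    \<open>z\<close>.\<close>
  have "x = (\<nu> - z) \<odot>\<^bsub>H\<^esub> r"
  proof (rule H.resolvent_unique[OF z])
    show "((\<nu> - z) \<odot>\<^bsub>H\<^esub> e, x) \<in> (rel_shift H ?A0 z)\<inverse>"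
    proof -
      have "(\<nu> - z) \<odot>\<^bsub>H\<^esub> e \<oplus>\<^bsub>H\<^esub> z \<odot>\<^bsub>H\<^esub> x = ?x'"
        unfolding e_def using dc xc by (intro H.ip_eqI) (simp_all add: H.ip_linear algebra_simps)
      then show ?thesis using x ec by (simp add: H.resolvent_iff[OF A0_lin] del: converse_iff)
    qed
    show "((\<nu> - z) \<odot>\<^bsub>H\<^esub> e, (\<nu> - z) \<odot>\<^bsub>H\<^esub> r) \<in> (rel_shift H ?A0 z)\<inverse>"
    proof -
      have "(\<nu> - z) \<odot>\<^bsub>H\<^esub> e \<oplus>\<^bsub>H\<^esub> z \<odot>\<^bsub>H\<^esub> ((\<nu> - z) \<odot>\<^bsub>H\<^esub> r) = (\<nu> - z) \<odot>\<^bsub>H\<^esub> (e \<oplus>\<^bsub>H\<^esub> z \<odot>\<^bsub>H\<^esub> r)"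
        using ec rc by (intro H.ip_eqI) (simp_all add: H.ip_linear algebra_simps)
      then show ?thesis using linear_relation_smult[OF A0_lin r, of "\<nu> - z"] ec
        by (simp add: H.resolvent_iff[OF A0_lin] del: converse_iff)
    qed
  qed
  then have "d = e \<oplus>\<^bsub>H\<^esub> (z - \<nu>) \<odot>\<^bsub>H\<^esub> r"
    unfolding e_def using dc rc by (intro H.ip_eqI) (simp_all add: H.ip_linear algebra_simps)
  moreover have "(e, r) \<in> (rel_shift H ?A0 z)\<inverse>"
    using r ec by (simp add: H.resolvent_iff[OF A0_lin] del: converse_iff)
  ultimately show ?thesis using gamma by blast
qed

text \<open>Provides the carrier condition of \<open>bounded_op_extends\<close>. A vanishing shifted
  value identifies \<open>e'\<close> with \<open>\<nu> e\<close>, so the pair to which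
  \<open>\<Gamma>0\<close> is applied does lie in \<open>T\<close>.\<close>

lemma gamma_field_carrier: "gamma_field H T \<Gamma>0 \<nu> \<subseteq> carrier G \<times> carrier H"
proof clarify
  fix k e assume "(k, e) \<in> gamma_field H T \<Gamma>0 \<nu>"
  then have e: "e \<in> rel_ker H (rel_shift H T \<nu>)" and k: "k = \<Gamma>0 (e, \<nu> \<odot>\<^bsub>H\<^esub> e)"
    by (auto simp: gamma_field_def defect_rel_def)
  then obtain e' where e': "(e, e') \<in> T" "e' \<ominus>\<^bsub>H\<^esub> \<nu> \<odot>\<^bsub>H\<^esub> e = \<zero>\<^bsub>H\<^esub>"
    unfolding rel_ker_def rel_shift_def by force
  note c = T_carrier[OF e'(1)]
  have "e' = \<nu> \<odot>\<^bsub>H\<^esub> e" using e'(2) c by (simp add: H.minus_eq_zero_iff)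
  then show "k \<in> carrier G \<and> e \<in> carrier H" using c e'(1) \<Gamma>0_simps(1) by (simp add: k)
qed

text \<open>The factors, read from left to right: boundary value in \<open>L\<close>, embedding into
  \<open>G\<close>, extension \<open>S\<close> of the \<gamma>-field at \<open>\<nu>\<close>, and
  passage from \<open>\<nu>\<close> to \<open>z\<close>. With \<open>S\<close> in place of the
  \<gamma>-field, all factors are bounded and everywhere defined.\<close>

theorem resolvent_difference:
  assumes A1: "selfadjoint_relation H (boundary_ker G T \<Gamma>1)"
    and z1: "z \<in> resolvent_set H (boundary_ker G T \<Gamma>1)"
    and z0: "z \<in> resolvent_set H (boundary_ker G T \<Gamma>0)"
    and \<nu>: "\<nu> \<in> resolvent_set H (boundary_ker G T \<Gamma>0)"
    and S: "S \<in> bounded_ops G H" "gamma_field H T \<Gamma>0 \<nu> \<subseteq> S"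
    and L: "hilbert_space L" "\<Gamma>0 ` T \<subseteq> carrier L" "Id_on (carrier L) \<in> bounded_ops L G"
  obtains K C where "K \<in> bounded_ops H L" "C \<in> bounded_ops H H"
    "rel_minus H ((rel_shift H (boundary_ker G T \<Gamma>1) z)\<inverse>) ((rel_shift H (boundary_ker G T \<Gamma>0) z)\<inverse>)
      = K O Id_on (carrier L) O S O C"
proof -
  let ?A0 = "boundary_ker G T \<Gamma>0" and ?A1 = "boundary_ker G T \<Gamma>1"
  let ?R0 = "(rel_shift H ?A0 z)\<inverse>" and ?R1 = "(rel_shift H ?A1 z)\<inverse>"
  have A0_lin: "linear_relation H H ?A0" and A1_lin: "linear_relation H H ?A1"
    using A0_selfadjoint A1 by (auto simp: selfadjoint_relation_def)
  have R0: "?R0 \<in> bounded_ops H H" and R1: "?R1 \<in> bounded_ops H H"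
    using z0 z1 by (auto simp: resolvent_set_def)
  define K where "K = {(f' \<ominus>\<^bsub>H\<^esub> z \<odot>\<^bsub>H\<^esub> f, \<Gamma>0 (f, f')) | f f'. (f, f') \<in> ?A1}"
  define C where "C = {(e, e \<oplus>\<^bsub>H\<^esub> (z - \<nu>) \<odot>\<^bsub>H\<^esub> r) | e r. (e, r) \<in> ?R0}"
  have K: "K \<in> bounded_ops H L"
    unfolding K_def by (rule boundary_value_bounded_op[OF A1 z1 L])
  have C: "C \<in> bounded_ops H H"
    unfolding C_def by (rule H.id_plus_smult_bounded_op[OF R0])
  let ?D = "rel_minus H ?R1 ?R0" and ?P = "K O Id_on (carrier L) O S O C"
  have sub: "(h, d) \<in> ?P" if "(h, d) \<in> ?D" for h d
  proof -
    obtain f1 f0 where f: "(h, f1) \<in> ?R1" "(h, f0) \<in> ?R0" and d: "d = f1 \<ominus>\<^bsub>H\<^esub> f0"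
      using \<open>(h, d) \<in> ?D\<close> unfolding rel_minus_def by blast
    have h: "h \<in> carrier H" using linear_relation_carrier[OF bounded_opsD(1)[OF R1] f(1)] by simp
    have f1: "(f1, h \<oplus>\<^bsub>H\<^esub> z \<odot>\<^bsub>H\<^esub> f1) \<in> ?A1" (is "(f1, ?f1') \<in> _")
      using f(1) H.resolvent_iff[OF A1_lin h] by blast
    have f0: "(f0, h \<oplus>\<^bsub>H\<^esub> z \<odot>\<^bsub>H\<^esub> f0) \<in> ?A0" (is "(f0, ?f0') \<in> _")
      using f(2) H.resolvent_iff[OF A0_lin h] by blast
    have T1: "(f1, ?f1') \<in> T" and T0: "(f0, ?f0') \<in> T" and z0: "\<Gamma>0 (f0, ?f0') = \<zero>\<^bsub>G\<^esub>"
      using f0 f1 by (auto simp: boundary_ker_def)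
    have c: "f1 \<in> carrier H" "f0 \<in> carrier H" using T_carrier T0 T1 by auto
    have "h = ?f1' \<ominus>\<^bsub>H\<^esub> z \<odot>\<^bsub>H\<^esub> f1"
      using h c by (intro H.ip_eqI) (simp_all add: H.ip_linear)
    then have hK: "(h, \<Gamma>0 (f1, ?f1')) \<in> K" unfolding K_def using f1 by blast
    have "?f1' \<ominus>\<^bsub>H\<^esub> ?f0' = z \<odot>\<^bsub>H\<^esub> d"
      unfolding d using h c by (intro H.ip_eqI) (simp_all add: H.ip_linear algebra_simps)
    then have dT: "(d, z \<odot>\<^bsub>H\<^esub> d) \<in> T"
      and "\<Gamma>0 (d, z \<odot>\<^bsub>H\<^esub> d) = \<Gamma>0 (f1, ?f1') \<ominus>\<^bsub>G\<^esub> \<zero>\<^bsub>G\<^esub>"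
      using T_diff[OF T1 T0] \<Gamma>0_diff[OF T1 T0] z0 by (simp_all add: d)
    then have "\<Gamma>0 (d, z \<odot>\<^bsub>H\<^esub> d) = \<Gamma>0 (f1, ?f1')"
      using \<Gamma>0_simps(1)[OF T1] by (simp add: a_minus_def)
    then obtain e r where e: "(\<Gamma>0 (f1, ?f1'), e) \<in> gamma_field H T \<Gamma>0 \<nu>"
      "(e, r) \<in> ?R0" "d = e \<oplus>\<^bsub>H\<^esub> (z - \<nu>) \<odot>\<^bsub>H\<^esub> r"
      using gamma_field_shift[OF \<open>z \<in> resolvent_set H ?A0\<close> \<nu> dT] by auto
    have "(e, d) \<in> C" unfolding C_def using e by blast
    moreover have "\<Gamma>0 (f1, ?f1') \<in> carrier L" using L(2) T1 by blast
    ultimately show ?thesis using hK e(1) S(2) by blast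
  qed
  \<comment> \<open>The reverse inclusion needs no further calculation: \<open>?D\<close> has a
    value wherever \<open>?P\<close> has one, by \<open>sub\<close> it is also a value of
    \<open>?P\<close>, and \<open>?P\<close> is single-valued.\<close>
  have "single_valued ?P"
    using bounded_opsD(2) K C S(1) by (intro single_valued_relcomp single_valued_Id_on) auto
  moreover have "\<exists>d'. (h, d') \<in> ?D" if "(h, d) \<in> ?P" for h d
  proof -
    have "h \<in> carrier H" using that bounded_opsD(3)[OF K] by blast
    then have "h \<in> Domain ?R1" "h \<in> Domain ?R0" using bounded_opsD(3) R0 R1 by blast+
    then show ?thesis unfolding rel_minus_def by blast
  qed
  ultimately have "?P \<subseteq> ?D" using sub unfolding single_valued_def by (metis subrelI)
  moreover have "?D \<subseteq> ?P" using sub by (rule subrelI)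
  ultimately have "?D = ?P" by (rule equalityI[rotated])
  then show thesis using that K C by blast
qed

end

section \<open>Membership of the resolvent difference in the product ideal\<close>

theorem theorem3p21:
  fixes H G :: "'u hilb"
    and A T A0 A1 :: "('u \<times> 'u) set"
    and \<Gamma>0 \<Gamma>1 :: "'u \<times> 'u \<Rightarrow> 'u"
    and \<gamma> M :: "complex \<Rightarrow> ('u \<times> 'u) set"
    and \<AA> \<BB> :: "'u op_family"
  assumes "separable_hilbert_space H"
    and "quasi_boundary_triple H A T G \<Gamma>0 \<Gamma>1"
    and "operator_ideal_class \<AA>"
    and "operator_ideal_class \<BB>"
  defines "A0 \<equiv> boundary_ker G T \<Gamma>0"
    and "A1 \<equiv> boundary_ker G T \<Gamma>1"
    and "\<gamma> \<equiv> gamma_field H T \<Gamma>0"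
    and "M \<equiv> weyl_function H T \<Gamma>0 \<Gamma>1"
  assumes i: "selfadjoint_relation H A1"
    and ii: "\<exists>\<mu> \<in> resolvent_set H A0. bounded_relation G G (M \<mu>)"
    and iii: "\<exists>\<nu> \<in> resolvent_set H A0. rel_adj G H (\<gamma> \<nu>) \<in> adj_class \<AA> H G"
    and iv: "\<exists>G0t :: 'u hilb. separable_hilbert_space G0t \<and>
        \<Gamma>0 ` T \<subseteq> carrier G0t \<and> carrier G0t \<subseteq> carrier G \<and>
        Id_on (carrier G0t) \<in> \<BB> G0t G"
  shows "\<forall>z \<in> resolvent_set H A1 \<inter> resolvent_set H A0.
    rel_minus H ((rel_shift H A1 z)\<inverse>) ((rel_shift H A0 z)\<inverse>) \<in> prod_class \<AA> \<BB> H H"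
proof
  fix z assume z: "z \<in> resolvent_set H A1 \<inter> resolvent_set H A0"
  interpret quasi_boundary_triple H A T G \<Gamma>0 \<Gamma>1 by fact
  interpret \<AA>: operator_ideal_class \<AA> by fact
  interpret \<BB>: operator_ideal_class \<BB> by fact
  note sepH = \<open>separable_hilbert_space H\<close>
  obtain \<nu> S where \<nu>: "\<nu> \<in> resolvent_set H A0" and S: "S \<in> \<AA> G H"
    and adj: "rel_adj G H (\<gamma> \<nu>) = rel_adj G H S"
    using iii unfolding adj_class_def by blast
  obtain L :: "'u hilb" where sepL: "separable_hilbert_space L"
    and ran: "\<Gamma>0 ` T \<subseteq> carrier L" and emb: "Id_on (carrier L) \<in> \<BB> L G"
    using iv by blast
  \<comment> \<open>The triple only makes \<open>G\<close> a Hilbert space; its separability is read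
    off from the index condition, since \<open>\<AA> G H\<close> is inhabited.\<close>
  have sepG: "separable_hilbert_space G" using \<AA>.index[OF S] by blast
  have S_bdd: "S \<in> bounded_ops G H"
    using \<AA>.compact[OF sepG sepH] S by (auto simp: compact_ops_def)
  have emb_bdd: "Id_on (carrier L) \<in> bounded_ops L G"
    using \<BB>.compact[OF sepL sepG] emb by (auto simp: compact_ops_def)
  have "\<gamma> \<nu> \<subseteq> S"
    using bounded_op_extends[OF G.hilbert_space_axioms H.cinner_space_axioms S_bdd _ adj]
      gamma_field_carrier unfolding \<gamma>_def by blast
  then obtain K C where K: "K \<in> bounded_ops H L" and C: "C \<in> bounded_ops H H"
    and eq: "rel_minus H ((rel_shift H A1 z)\<inverse>) ((rel_shift H A0 z)\<inverse>)
      = K O Id_on (carrier L) O S O C"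
    using resolvent_difference[of z \<nu> S L] i z \<nu> S_bdd ran emb_bdd
      separable_hilbert_space.axioms(1)[OF sepL]
    unfolding A0_def A1_def \<gamma>_def by blast
  \<comment> \<open>The chain is cut at \<open>G\<close>, the intermediate space of the product.
    Identities of \<open>G\<close> are inserted at the cut because the ideal law \<open>comp\<close>
    takes a bounded factor on each side.\<close>
  have "K O Id_on (carrier L) O Id_on (carrier G) \<in> \<BB> H G"
    by (rule \<BB>.comp[OF sepL sepG sepH sepG emb K G.Id_on_bounded_op])
  moreover have "Id_on (carrier G) O S O C \<in> \<AA> G H"
    by (rule \<AA>.comp[OF sepG sepH sepG sepH S G.Id_on_bounded_op C])
  moreover have "K O Id_on (carrier L) O S O C
      = (K O Id_on (carrier L) O Id_on (carrier G)) O (Id_on (carrier G) O S O C)"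
    using linear_relation_carrier(1)[OF bounded_opsD(1)[OF S_bdd]] by blast
  ultimately show "rel_minus H ((rel_shift H A1 z)\<inverse>) ((rel_shift H A0 z)\<inverse>) \<in> prod_class \<AA> \<BB> H H"
    unfolding prod_class_def eq using sepG by blast
qed

end
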